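(* Let $W\in\mathbb{R}^{d_1\times d_0}$ have i.i.d. $\mathcal{N}(0,1)$ entries. Let $X=(\mathbf{x}_1,\dots,\mathbf{x}_n)\in\mathbb{R}^{d_0\times n}$ be deterministic with $\sum_{i=1}^n(\|\mathbf{x}_i\|^2-1)^2\le B^2$ for a constant $B\ge0$, and let $\sigma:\mathbb{R}\to\mathbb{R}$ be $\lambda_\sigma$-Lipschitz with $\mathbb{E}[\sigma(\xi)]=0$, where $\xi\sim\mathcal{N}(0,1)$. Then with probability at least $1-4e^{-2n}$, $$\left\|\frac{1}{d_1}Y^\top Y-\Phi\right\|\le C\left(\sqrt{\frac{n}{d_1}}+\frac{n}{d_1}\right)\lambda_\sigma^2\|X\|^2+32B\lambda_\sigma^2\|X\|\sqrt{\frac{n}{d_1}},$$ where $C>0$ is a universal constant.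
   Context: $Y:=\sigma(WX)\in\mathbb{R}^{d_1\times n}$ with $\sigma$ applied entrywise, and $\Phi:=\mathbb{E}_{\mathbf{w}}[\sigma(\mathbf{w}^\top X)^\top\sigma(\mathbf{w}^\top X)]\in\mathbb{R}^{n\times n}$ with $\mathbf{w}\sim\mathcal{N}(0,\mathrm{Id}_{d_0})$. For matrices $\|\cdot\|$ is the spectral norm; for vectors it is the $\ell_2$-norm. *)

theory Defs
  imports "HOL-Probability.Probability" "Jordan_Normal_Form.Matrix"
begin

definition l2_norm :: "real vec \<Rightarrow> real" where
  "l2_norm v = L2_set (\<lambda>i. vec_index v i) {..<dim_vec v}"

definition spectral_norm :: "real mat \<Rightarrow> real" where
  "spectral_norm A = (SUP v \<in> {v \<in> carrier_vec (dim_col A). l2_norm v \<le> 1}. l2_norm (A *\<^sub>v v))"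

definition gaussian_vector :: "nat \<Rightarrow> (nat \<Rightarrow> real) measure" where
  "gaussian_vector d = (\<Pi>\<^sub>M i\<in>{..<d}. std_normal_distribution)"

text \<open>The law of a \<open>d1 \<times> d0\<close> array of i.i.d. standard normal entries. A sample \<open>\<omega>\<close> is
  indexed by pairs, so \<open>mat d1 d0 \<omega>\<close> is the random matrix itself.\<close>
definition gaussian_matrix :: "nat \<Rightarrow> nat \<Rightarrow> (nat \<times> nat \<Rightarrow> real) measure" where
  "gaussian_matrix d1 d0 = (\<Pi>\<^sub>M p\<in>{..<d1} \<times> {..<d0}. std_normal_distribution)"

text \<open>Integrating against \<^const>\<open>gaussian_matrix\<close> is no restriction: an i.i.d. standard normal
  array on any probability space has this law.\<close>
lemma (in prob_space) distr_iid_std_normal: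
  fixes W :: "nat \<times> nat \<Rightarrow> 'a \<Rightarrow> real"
  assumes ind: "indep_vars (\<lambda>_. borel) W ({..<d1} \<times> {..<d0})"
    and law: "\<And>p. p \<in> {..<d1} \<times> {..<d0} \<Longrightarrow> distributed M lborel (W p) std_normal_density"
    and pos: "0 < d1" "0 < d0"
  shows "distr M (\<Pi>\<^sub>M p\<in>{..<d1} \<times> {..<d0}. borel) (\<lambda>x. \<lambda>p\<in>{..<d1} \<times> {..<d0}. W p x)
    = gaussian_matrix d1 d0"
proof -
  let ?I = "{..<d1} \<times> {..<d0}"
  have rv: "random_variable borel (W p)" if "p \<in> ?I" for p
    using ind that by (auto simp: indep_vars_def)
  have eq: "distr M borel (W p) = std_normal_distribution" if "p \<in> ?I" for p
  proof -
    have "distr M borel (W p) = distr M lborel (W p)"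
      by (rule distr_cong) auto
    then show ?thesis
      using law[OF that] by (simp add: distributed_def)
  qed
  have ne: "?I \<noteq> {}"
    using pos by auto
  have "distr M (\<Pi>\<^sub>M p\<in>?I. borel) (\<lambda>x. \<lambda>p\<in>?I. W p x) = (\<Pi>\<^sub>M p\<in>?I. distr M borel (W p))"
    using indep_vars_iff_distr_eq_PiM'[OF ne rv] ind by simp
  also have "\<dots> = gaussian_matrix d1 d0"
    unfolding gaussian_matrix_def by (rule PiM_cong) (auto simp: eq)
  finally show ?thesis .
qed

text \<open>\<open>\<Phi>\<close>, with the expectation taken entrywise and \<open>w\<^sup>T\<close> read as a row matrix.\<close>
definition Phi :: "(real \<Rightarrow> real) \<Rightarrow> real mat \<Rightarrow> real mat" where
  "Phi \<sigma> X = mat (dim_col X) (dim_col X) (\<lambda>p.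
     \<integral>w. (let y = map_mat \<sigma> (mat_of_row (vec (dim_row X) w) * X)
          in (transpose_mat y * y) $$ p) \<partial>gaussian_vector (dim_row X))"

end

theory Submission imports Defs
begin

text \<open>
  Write \<open>y\<^sub>r\<close> for the \<open>r\<close>-th row of \<open>Y\<close>. The rows are i.i.d. and \<open>\<Phi>\<close> is the second moment matrix of one of them, so
  for a fixed vector \<open>a\<close> of the unit ball the quadratic form \<open>a\<^sup>T (Y\<^sup>T Y / d1 - \<Phi>) a\<close> is the deviation of the empirical
  mean of \<open>f\<^sup>2\<close> from its expectation, where \<open>f(w) = \<Sum>\<^sub>i a\<^sub>i \<sigma>(x\<^sub>i\<^sup>T w)\<close> is a function of one Gaussian vector with
  Lipschitz constant \<open>L = l \<parallel>X\<parallel>\<close>. The proof controls this number for each \<open>a\<close> of a \<open>1/4\<close>-net of the unit ball with at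
  most \<open>48\<^sup>n\<close> points, and a symmetric matrix has norm at most twice the largest quadratic form over such a net
  (\<open>spectral_norm_le_net\<close>). Since \<open>48 < e\<^sup>4\<close>, failure probabilities of order \<open>e\<^bsup>-6n\<^esup>\<close> at each net point suffice.

  For one net point, split \<open>f = \<mu> + g\<close> with \<open>\<mu> = E f\<close>. The deviation becomes
  \<open>(1/d1) \<Sum>\<^sub>r (g(w\<^sub>r)\<^sup>2 - E g\<^sup>2) + 2 \<mu> (1/d1) \<Sum>\<^sub>r g(w\<^sub>r)\<close> (\<open>quadratic_form_eq_sums\<close>). Gaussian concentration makes \<open>g\<close>
  sub-Gaussian with variance proxy \<open>4 L\<^sup>2\<close> (\<open>ridge_mgf\<close>). Hence \<open>g\<^sup>2 - E g\<^sup>2\<close> is sub-exponential, and Chernoff's bound for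
  independent rows gives the terms \<open>sqrt (n/d1) + n/d1\<close> from the squares and \<open>sqrt (n/d1)\<close> from the linear sum. The mean
  \<open>\<mu>\<close> vanishes when all columns of \<open>X\<close> have norm one, because \<open>\<sigma>\<close> is centred; in general \<open>\<bar>\<mu>\<bar> \<le> l B\<close>
  (\<open>abs_mean_le\<close>), which is where \<open>B\<close> enters. The constant \<open>32 = 2 \<cdot> 2 \<cdot> 8\<close> is the product of the net factor, the factor of
  the cross term and the deviation \<open>8 L sqrt (n/d1)\<close> allowed to the linear sum.

  Concentration is proved by the Maurey--Pisier argument. If \<open>x, y\<close> are independent Gaussian vectors, the quarter circle
  \<open>cos \<theta> x + sin \<theta> y\<close> leads from \<open>x\<close> to \<open>y\<close>, and the rotation invariance of the Gaussian law makes all its small arcs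
  equally distributed. Convexity of the exponential then bounds \<open>E exp (t (f y - f x))\<close> by the contribution of a single arc,
  which in the limit is the moment generating function of \<open>(\<pi>/2) \<nabla>f(x) \<bullet> y\<close>, a Gaussian variable given \<open>x\<close>. The
  Lipschitz function \<open>\<sigma>\<close> is replaced by a uniformly close differentiable one beforehand.
\<close>

section \<open>The spectral norm\<close>

lemma l2_norm_nonneg: "0 \<le> l2_norm v"
  by (simp add: l2_norm_def L2_set_nonneg)

lemma l2_norm_power2: "(l2_norm v)\<^sup>2 = (\<Sum>i<dim_vec v. (v $ i)\<^sup>2)"
  by (simp add: l2_norm_def L2_set_def sum_nonneg)

lemma l2_norm_power2_eq_scalar_prod: "(l2_norm v)\<^sup>2 = v \<bullet> v"
  unfolding l2_norm_power2 by (simp add: scalar_prod_def power2_eq_square atLeast0LessThan)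

lemma abs_scalar_prod_le:
  assumes "u \<in> carrier_vec n" "v \<in> carrier_vec n"
  shows "\<bar>u \<bullet> v\<bar> \<le> l2_norm u * l2_norm v"
proof -
  have "\<bar>u \<bullet> v\<bar> \<le> (\<Sum>i<n. \<bar>u $ i\<bar> * \<bar>v $ i\<bar>)"
    using assms by (auto simp: scalar_prod_def atLeast0LessThan abs_mult[symmetric] intro: sum_abs)
  also have "\<dots> \<le> l2_norm u * l2_norm v"
    using assms L2_set_mult_ineq[of "\<lambda>i. u $ i" "\<lambda>i. v $ i" "{..<n}"] by (simp add: l2_norm_def)
  finally show ?thesis .
qed

lemma l2_norm_smult: "l2_norm (c \<cdot>\<^sub>v v) = \<bar>c\<bar> * l2_norm v"
proof -
  have "(l2_norm (c \<cdot>\<^sub>v v))\<^sup>2 = (\<bar>c\<bar> * l2_norm v)\<^sup>2"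
    by (simp add: l2_norm_power2 power_mult_distrib sum_distrib_left)
  then show ?thesis
    by (simp add: l2_norm_nonneg power2_eq_iff_nonneg)
qed

lemma l2_norm_add_le:
  assumes "u \<in> carrier_vec n" "v \<in> carrier_vec n"
  shows "l2_norm (u + v) \<le> l2_norm u + l2_norm v"
proof -
  have "L2_set (\<lambda>i. (u + v) $ i) {..<n} = L2_set (\<lambda>i. u $ i + v $ i) {..<n}"
    using assms by (intro L2_set_cong) auto
  then show ?thesis
    using assms L2_set_triangle_ineq[of "\<lambda>i. u $ i" "\<lambda>i. v $ i" "{..<n}"] by (simp add: l2_norm_def)
qed

lemma l2_norm_zero: "l2_norm (0\<^sub>v n) = 0"
  by (simp add: l2_norm_def L2_set_def)

lemma l2_norm_mult_mat_vec_bound: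
  assumes "v \<in> carrier_vec (dim_col A)"
  shows "l2_norm (A *\<^sub>v v) \<le> L2_set (\<lambda>i. l2_norm (row A i)) {..<dim_row A} * l2_norm v"
proof -
  have "l2_norm (A *\<^sub>v v) \<le> L2_set (\<lambda>i. l2_norm (row A i) * l2_norm v) {..<dim_row A}"
  proof -
    have "(\<Sum>i<dim_row A. (row A i \<bullet> v)\<^sup>2) \<le> (\<Sum>i<dim_row A. (l2_norm (row A i) * l2_norm v)\<^sup>2)"
      using assms by (intro sum_mono abs_le_square_iff[THEN iffD1])
        (auto simp: l2_norm_nonneg intro!: order.trans[OF abs_scalar_prod_le[of _ "dim_col A"]])
    then show ?thesis
      by (simp add: l2_norm_def L2_set_def)
  qed
  then show ?thesis
    by (simp add: L2_set_left_distrib l2_norm_nonneg)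
qed

text \<open>The supremum in \<^const>\<open>spectral_norm\<close> is taken in the reals, so it is meaningful only because the Frobenius
  norm bounds it.\<close>

lemma spectral_norm_bdd_above:
  "bdd_above ((\<lambda>v. l2_norm (A *\<^sub>v v)) ` {v \<in> carrier_vec (dim_col A). l2_norm v \<le> 1})"
proof (rule bdd_aboveI2)
  fix v assume "v \<in> {v \<in> carrier_vec (dim_col A). l2_norm v \<le> 1}"
  then show "l2_norm (A *\<^sub>v v) \<le> L2_set (\<lambda>i. l2_norm (row A i)) {..<dim_row A}"
    by (intro order.trans[OF l2_norm_mult_mat_vec_bound]) (auto intro!: mult_left_le L2_set_nonneg)
qed

lemma spectral_norm_le_iff:
  "spectral_norm A \<le> c \<longleftrightarrow>
    (\<forall>v \<in> carrier_vec (dim_col A). l2_norm v \<le> 1 \<longrightarrow> l2_norm (A *\<^sub>v v) \<le> c)"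
proof -
  have "0\<^sub>v (dim_col A) \<in> {v \<in> carrier_vec (dim_col A). l2_norm v \<le> 1}"
    by (simp add: l2_norm_zero)
  then have "{v \<in> carrier_vec (dim_col A). l2_norm v \<le> 1} \<noteq> {}"
    by blast
  from cSUP_le_iff[OF this spectral_norm_bdd_above] show ?thesis
    unfolding spectral_norm_def by auto
qed

lemma l2_norm_mult_le_spectral_norm:
  assumes v: "v \<in> carrier_vec (dim_col A)"
  shows "l2_norm (A *\<^sub>v v) \<le> spectral_norm A * l2_norm v"
proof (cases "l2_norm v = 0")
  case True
  then show ?thesis
    using l2_norm_mult_mat_vec_bound[OF v] by simp
next
  case False
  then have pos: "l2_norm v > 0"
    using l2_norm_nonneg[of v] by simp
  define w where "w = (1 / l2_norm v) \<cdot>\<^sub>v v"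
  have "w \<in> carrier_vec (dim_col A)" "l2_norm w \<le> 1"
    using v pos by (auto simp: w_def l2_norm_smult)
  then have "l2_norm (A *\<^sub>v w) \<le> spectral_norm A"
    using spectral_norm_le_iff by blast
  moreover have "A *\<^sub>v w = (1 / l2_norm v) \<cdot>\<^sub>v (A *\<^sub>v v)"
    unfolding w_def using v by (intro mult_mat_vec[of _ "dim_row A" "dim_col A"]) auto
  ultimately show ?thesis
    using pos by (simp add: l2_norm_smult field_simps)
qed

lemma spectral_norm_nonneg: "0 \<le> spectral_norm A"
proof -
  have "l2_norm (A *\<^sub>v 0\<^sub>v (dim_col A)) \<le> spectral_norm A"
    using spectral_norm_le_iff[of A "spectral_norm A"] by (simp add: l2_norm_zero)
  then show ?thesis
    using l2_norm_nonneg order.trans by blast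
qed

text \<open>Polarization turns the bilinear form \<open>v\<^sup>T M u\<close> with \<open>v = M u / \<parallel>M u\<parallel>\<close> into quadratic forms, and the
  parallelogram identity keeps the constant equal to one.\<close>

lemma spectral_norm_le_quadratic_form:
  assumes M: "M \<in> carrier_mat n n" and sym: "transpose_mat M = M"
    and Q: "\<And>v. v \<in> carrier_vec n \<Longrightarrow> l2_norm v \<le> 1 \<Longrightarrow> \<bar>v \<bullet> (M *\<^sub>v v)\<bar> \<le> Q"
  shows "spectral_norm M \<le> Q"
proof -
  have Q0: "0 \<le> Q"
    using Q[of "0\<^sub>v n"] by (simp add: l2_norm_zero)
  have hom: "\<bar>v \<bullet> (M *\<^sub>v v)\<bar> \<le> Q * (l2_norm v)\<^sup>2" if v: "v \<in> carrier_vec n" for v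
  proof (cases "l2_norm v = 0")
    case True
    then have "\<bar>v \<bullet> (M *\<^sub>v v)\<bar> \<le> 0"
      using abs_scalar_prod_le[OF v, of "M *\<^sub>v v"] M v by auto
    then show ?thesis by (simp add: True)
  next
    case False
    define w where "w = (1 / l2_norm v) \<cdot>\<^sub>v v"
    have w: "w \<in> carrier_vec n" "l2_norm w \<le> 1" "v = l2_norm v \<cdot>\<^sub>v w"
      using v False by (auto simp: w_def l2_norm_smult smult_smult_assoc l2_norm_nonneg)
    have "v \<bullet> (M *\<^sub>v v) = (l2_norm v)\<^sup>2 * (w \<bullet> (M *\<^sub>v w))"
    proof -
      have "M *\<^sub>v v = l2_norm v \<cdot>\<^sub>v (M *\<^sub>v w)"
        using w M by (metis mult_mat_vec)
      then have "v \<bullet> (M *\<^sub>v v) = (l2_norm v \<cdot>\<^sub>v w) \<bullet> (l2_norm v \<cdot>\<^sub>v (M *\<^sub>v w))"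
        using w(3) by simp
      also have "\<dots> = (l2_norm v)\<^sup>2 * (w \<bullet> (M *\<^sub>v w))"
        using w(1) M by (simp add: scalar_prod_smult_left scalar_prod_smult_right power2_eq_square)
      finally show ?thesis .
    qed
    then show ?thesis
      using Q[OF w(1,2)] by (simp add: abs_mult mult_right_mono mult.commute)
  qed
  have "l2_norm (M *\<^sub>v u) \<le> Q" if u: "u \<in> carrier_vec n" "l2_norm u \<le> 1" for u
  proof (cases "l2_norm (M *\<^sub>v u) = 0")
    case True
    then show ?thesis using Q0 by simp
  next
    case False
    define v where "v = (1 / l2_norm (M *\<^sub>v u)) \<cdot>\<^sub>v (M *\<^sub>v u)"
    have Mu: "M *\<^sub>v u \<in> carrier_vec n" using M u by auto
    have v: "v \<in> carrier_vec n" "l2_norm v = 1"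
      using False Mu by (auto simp: v_def l2_norm_smult l2_norm_nonneg)
    have Mv: "M *\<^sub>v v \<in> carrier_vec n" using M v by auto
    have vMu: "v \<bullet> (M *\<^sub>v u) = l2_norm (M *\<^sub>v u)"
      using False Mu unfolding v_def
      by (simp add: scalar_prod_smult_left l2_norm_power2_eq_scalar_prod[symmetric] power2_eq_square)
    have uMv: "u \<bullet> (M *\<^sub>v v) = v \<bullet> (M *\<^sub>v u)"
      using transpose_vec_mult_scalar[OF M u(1) v(1)] sym M Mu Mv u v
      by (metis comm_scalar_prod)
    \<comment> \<open>polarization: the bilinear form of a symmetric matrix is a difference of quadratic forms\<close>
    have "4 * (v \<bullet> (M *\<^sub>v u)) = (u + v) \<bullet> (M *\<^sub>v (u + v)) - (u - v) \<bullet> (M *\<^sub>v (u - v))"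
      using u v M Mu Mv uMv
      by (simp add: mult_add_distrib_mat_vec[OF M] mult_minus_distrib_mat_vec[OF M]
          add_scalar_prod_distrib[of _ n] scalar_prod_add_distrib[of _ n]
          minus_scalar_prod_distrib[of _ n] scalar_prod_minus_distrib[of _ n])
    also have "\<dots> \<le> Q * ((l2_norm (u + v))\<^sup>2 + (l2_norm (u - v))\<^sup>2)"
      using hom[of "u + v"] hom[of "u - v"] u v by (simp add: distrib_left)
    also have "(l2_norm (u + v))\<^sup>2 + (l2_norm (u - v))\<^sup>2 = 2 * (l2_norm u)\<^sup>2 + 2 * (l2_norm v)\<^sup>2"
      using u(1) v(1) unfolding l2_norm_power2
      by (simp add: sum_distrib_left power2_eq_square algebra_simps flip: sum.distrib)
    also have "Q * \<dots> \<le> Q * 4"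
      using Q0 u v l2_norm_nonneg[of u] by (intro mult_left_mono) (auto simp: power_le_one)
    finally show ?thesis
      using vMu by simp
  qed
  then show ?thesis
    using M by (auto simp: spectral_norm_le_iff)
qed

text \<open>Moving from a vector of the ball to a net point at distance \<open>1/4\<close> changes the quadratic form by at most
  \<open>2 \<cdot> \<parallel>M\<parallel> / 4\<close>; this is absorbed on the left-hand side.\<close>

lemma spectral_norm_le_net:
  assumes M: "M \<in> carrier_mat n n" and sym: "transpose_mat M = M"
    and N: "N \<subseteq> {a \<in> carrier_vec n. l2_norm a \<le> 1}"
    and net: "\<And>v. v \<in> carrier_vec n \<Longrightarrow> l2_norm v \<le> 1 \<Longrightarrow> \<exists>a\<in>N. l2_norm (v - a) \<le> 1 / 4"
    and r: "\<And>a. a \<in> N \<Longrightarrow> \<bar>a \<bullet> (M *\<^sub>v a)\<bar> \<le> r"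
  shows "spectral_norm M \<le> 2 * r"
proof -
  let ?S = "spectral_norm M"
  have "?S \<le> r + ?S / 2"
  proof (rule spectral_norm_le_quadratic_form[OF M sym])
    fix v assume v: "v \<in> carrier_vec n" "l2_norm v \<le> 1"
    then obtain a where a: "a \<in> N" "l2_norm (v - a) \<le> 1 / 4"
      using net by blast
    then have a': "a \<in> carrier_vec n" "l2_norm a \<le> 1"
      using N by auto
    have mat_le: "\<bar>x \<bullet> (M *\<^sub>v y)\<bar> \<le> l2_norm x * (?S * l2_norm y)"
      if "x \<in> carrier_vec n" "y \<in> carrier_vec n" for x y
      using that M abs_scalar_prod_le[of x n "M *\<^sub>v y"] l2_norm_mult_le_spectral_norm[of y M]
      by (auto intro: order.trans mult_left_mono[OF _ l2_norm_nonneg])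
    have "v \<bullet> (M *\<^sub>v v) = a \<bullet> (M *\<^sub>v a) + (v - a) \<bullet> (M *\<^sub>v v) + a \<bullet> (M *\<^sub>v (v - a))"
    proof -
      have Mv: "M *\<^sub>v v \<in> carrier_vec n" "M *\<^sub>v a \<in> carrier_vec n"
        using M v a' by auto
      show ?thesis
        using v a' Mv by (simp add: mult_minus_distrib_mat_vec[OF M]
          minus_scalar_prod_distrib[of _ n] scalar_prod_minus_distrib[of _ n])
    qed
    moreover have "\<bar>(v - a) \<bullet> (M *\<^sub>v v)\<bar> \<le> 1 / 4 * (?S * 1)"
      using v a a' spectral_norm_nonneg[of M]
      by (intro order.trans[OF mat_le] mult_mono) (auto simp: l2_norm_nonneg)
    moreover have "\<bar>a \<bullet> (M *\<^sub>v (v - a))\<bar> \<le> 1 * (?S * (1 / 4))"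
      using v a a' spectral_norm_nonneg[of M]
      by (intro order.trans[OF mat_le] mult_mono) (auto simp: l2_norm_nonneg)
    ultimately show "\<bar>v \<bullet> (M *\<^sub>v v)\<bar> \<le> r + ?S / 2"
      using r[OF a(1)] by linarith
  qed
  then show ?thesis by simp
qed

section \<open>Nets from a truncated lattice\<close>

text \<open>Rounding each coordinate towards zero to a multiple of \<open>h\<close> cannot increase its absolute value, so the rounded
  vector stays in the unit ball. The bound on the \<open>l1\<close> norm of the integer vector is what makes the net small.\<close>

lemma truncate_to_grid:
  assumes v: "v \<in> carrier_vec n" "l2_norm v \<le> 1" and h: "0 < h"
  obtains z :: "nat \<Rightarrow> int" where
    "l2_norm (vec n (\<lambda>i. h * of_int (z i))) \<le> 1"
    "l2_norm (v - vec n (\<lambda>i. h * of_int (z i))) \<le> h * sqrt (real n)"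
    "h * (\<Sum>i<n. \<bar>of_int (z i)\<bar>) \<le> sqrt (real n)"
    "z \<in> extensional {..<n}"
proof
  define z where "z = (\<lambda>i\<in>{..<n}. if v $ i \<ge> 0 then \<lfloor>v $ i / h\<rfloor> else - \<lfloor>- v $ i / h\<rfloor>)"
  have z: "\<bar>h * of_int (z i)\<bar> \<le> \<bar>v $ i\<bar> \<and> \<bar>v $ i - h * of_int (z i)\<bar> \<le> h" if "i < n" for i
  proof -
    have trunc: "0 \<le> h * of_int \<lfloor>x / h\<rfloor> \<and> h * of_int \<lfloor>x / h\<rfloor> \<le> x \<and> x - h * of_int \<lfloor>x / h\<rfloor> \<le> h"
      if "x \<ge> 0" for x
    proof -
      have "0 \<le> h * of_int \<lfloor>x / h\<rfloor>"
        using that h by simp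
      moreover have "h * of_int \<lfloor>x / h\<rfloor> \<le> h * (x / h)"
        by (rule mult_left_mono[OF of_int_floor_le]) (use h in simp)
      moreover have "h * (x / h) \<le> h * (of_int \<lfloor>x / h\<rfloor> + 1)"
        by (rule mult_left_mono[OF real_of_int_floor_add_one_ge]) (use h in simp)
      ultimately show ?thesis using h by (simp add: distrib_left)
    qed
    show ?thesis
    proof (cases "v $ i \<ge> 0")
      case True
      then show ?thesis using that trunc[of "v $ i"] by (simp add: z_def)
    next
      case False
      then show ?thesis using that trunc[of "- v $ i"] by (simp add: z_def)
    qed
  qed
  have norm_le: "l2_norm (vec n f) \<le> c" if "(\<Sum>i<n. (f i)\<^sup>2) \<le> c\<^sup>2" "0 \<le> c" for f :: "nat \<Rightarrow> real" and c
    by (rule power2_le_imp_le) (use that in \<open>simp_all add: l2_norm_power2\<close>)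
  have v1: "(\<Sum>i<n. (v $ i)\<^sup>2) \<le> 1"
    using v l2_norm_nonneg[of v] power_le_one[of "l2_norm v" 2] by (simp add: l2_norm_power2)
  have "(\<Sum>i<n. (h * of_int (z i))\<^sup>2) \<le> (\<Sum>i<n. (v $ i)\<^sup>2)"
    by (rule sum_mono, rule abs_le_square_iff[THEN iffD1]) (use z in blast)
  then show "l2_norm (vec n (\<lambda>i. h * of_int (z i))) \<le> 1"
    using v1 norm_le[of "\<lambda>i. h * of_int (z i)" 1] by simp
  have "(\<Sum>i<n. (v $ i - h * of_int (z i))\<^sup>2) \<le> (\<Sum>i<n. h\<^sup>2)"
    by (rule sum_mono, rule power2_le_iff_abs_le[THEN iffD2]) (use z h in auto)
  moreover have "v - vec n (\<lambda>i. h * of_int (z i)) = vec n (\<lambda>i. v $ i - h * of_int (z i))"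
    using v by auto
  ultimately show "l2_norm (v - vec n (\<lambda>i. h * of_int (z i))) \<le> h * sqrt (real n)"
    using h norm_le[of "\<lambda>i. v $ i - h * of_int (z i)" "h * sqrt (real n)"]
    by (simp add: power_mult_distrib mult.commute[of _ "real n"])
  have "h * (\<Sum>i<n. \<bar>of_int (z i)\<bar>) \<le> (\<Sum>i<n. \<bar>v $ i\<bar>)"
    unfolding sum_distrib_left
  proof (rule sum_mono)
    fix i assume "i \<in> {..<n}"
    then show "h * \<bar>of_int (z i)\<bar> \<le> \<bar>v $ i\<bar>"
      using z[of i] h by (simp add: abs_mult)
  qed
  also have "\<dots> \<le> L2_set (\<lambda>i. v $ i) {..<n} * L2_set (\<lambda>i. 1) {..<n}"
    using L2_set_mult_ineq[of "\<lambda>i. v $ i" "\<lambda>i. 1" "{..<n}"] by simp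
  also have "\<dots> \<le> 1 * sqrt (real n)"
    by (rule mult_mono) (use v in \<open>simp_all add: l2_norm_def L2_set_nonneg, simp add: L2_set_def\<close>)
  finally show "h * (\<Sum>i<n. \<bar>of_int (z i)\<bar>) \<le> sqrt (real n)" by simp
  show "z \<in> extensional {..<n}" by (simp add: z_def)
qed

lemma sum_half_powers_le: "(\<Sum>k\<in>{- int m..int m}. (1 / 2 :: real) ^ nat \<bar>k\<bar>) \<le> 3 - 2 * (1/2)^m"
proof (induction m)
  case (Suc m)
  have "{- int (Suc m)..int (Suc m)} = insert (int (Suc m)) (insert (- int (Suc m)) {- int m..int m})"
    by auto
  moreover have "nat (1 + int m) = Suc m" "nat (int m + 1) = Suc m"
    by auto
  ultimately show ?case using Suc by simp
qed simp

text \<open>Each counted vector has weight \<open>2\<^bsup>m - \<Sum>\<bar>z i\<bar>\<^esup> \<ge> 1\<close>, and the total weight of all vectors factors over the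
  coordinates into sums bounded by \<open>3\<close>.\<close>

lemma card_integer_vectors_le:
  "card {z \<in> {..<n} \<rightarrow>\<^sub>E {- int m..int m}. (\<Sum>i<n. \<bar>z i\<bar>) \<le> int m} \<le> 2 ^ m * 3 ^ n"
proof -
  let ?Z = "{..<n} \<rightarrow>\<^sub>E {- int m..int m}"
  let ?S = "{z \<in> ?Z. (\<Sum>i<n. \<bar>z i\<bar>) \<le> int m}"
  have fin: "finite ?Z" by (intro finite_PiE) auto
  have "real (card ?S) = (\<Sum>z\<in>?S. 1)" by simp
  also have "\<dots> \<le> (\<Sum>z\<in>?S. 2 ^ m * (\<Prod>i<n. (1/2) ^ nat \<bar>z i\<bar>))"
  proof (rule sum_mono)
    fix z assume z: "z \<in> ?S"
    have "(\<Sum>i<n. \<bar>z i\<bar>) \<le> int m"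
      using z by blast
    moreover have "int (\<Sum>i<n. nat \<bar>z i\<bar>) = (\<Sum>i<n. \<bar>z i\<bar>)"
      by simp
    ultimately have "(\<Sum>i<n. nat \<bar>z i\<bar>) \<le> m"
      by linarith
    then have "(1/2::real) ^ m \<le> (1/2) ^ (\<Sum>i<n. nat \<bar>z i\<bar>)"
      by (intro power_decreasing) auto
    also have "\<dots> = (\<Prod>i<n. (1/2) ^ nat \<bar>z i\<bar>)" by (simp add: power_sum)
    finally have "2 ^ m * (1/2::real) ^ m \<le> 2 ^ m * (\<Prod>i<n. (1/2) ^ nat \<bar>z i\<bar>)"
      by (rule mult_left_mono) simp
    then show "1 \<le> (2::real) ^ m * (\<Prod>i<n. (1/2) ^ nat \<bar>z i\<bar>)"
      by (simp only: power_mult_distrib[symmetric]) simp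
  qed
  also have "\<dots> \<le> (\<Sum>z\<in>?Z. 2 ^ m * (\<Prod>i<n. (1/2) ^ nat \<bar>z i\<bar>))"
    by (rule sum_mono2[OF fin Collect_restrict], rule mult_nonneg_nonneg[OF _ prod_nonneg]) simp_all
  also have "\<dots> = 2 ^ m * (\<Prod>i<n. \<Sum>k\<in>{- int m..int m}. (1/2) ^ nat \<bar>k\<bar>)"
    by (simp only: prod_sum_PiE finite_lessThan finite_atLeastAtMost_int sum_distrib_left)
  also have "\<dots> \<le> 2 ^ m * (\<Prod>i<n. 3)"
  proof (intro mult_left_mono prod_mono conjI)
    show "(\<Sum>k\<in>{- int m..int m}. (1/2) ^ nat \<bar>k\<bar>) \<le> (3 :: real)"
      by (rule order.trans[OF sum_half_powers_le]) simp
  qed (simp_all add: sum_nonneg)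
  finally have "real (card ?S) \<le> real (2 ^ m * 3 ^ n)"
    by (simp only: prod_constant card_lessThan of_nat_mult of_nat_power of_nat_numeral)
  then show ?thesis by (simp only: of_nat_le_iff)
qed

text \<open>Mesh \<open>1 / (4 sqrt n)\<close> gives distance at most \<open>1/4\<close> and integer vectors of \<open>l1\<close> norm at most \<open>4 n\<close>, hence
  \<open>2\<^bsup>4n\<^esup> 3\<^sup>n = 48\<^sup>n\<close> points.\<close>

lemma exists_quarter_net:
  assumes n: "n \<ge> 1"
  obtains N where "finite N" "card N \<le> 48 ^ n" "N \<subseteq> {a \<in> carrier_vec n. l2_norm a \<le> 1}"
    "\<And>v. v \<in> carrier_vec n \<Longrightarrow> l2_norm v \<le> 1 \<Longrightarrow> \<exists>a\<in>N. l2_norm (v - a) \<le> 1 / 4"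
proof -
  define h where "h = 1 / (4 * sqrt (real n))"
  define Z where "Z = {z \<in> {..<n} \<rightarrow>\<^sub>E {- int (4 * n)..int (4 * n)}. (\<Sum>i<n. \<bar>z i\<bar>) \<le> int (4 * n)}"
  define N where "N = {a \<in> (\<lambda>z. vec n (\<lambda>i. h * of_int (z i))) ` Z. l2_norm a \<le> 1}"
  have h: "h > 0" using n by (simp add: h_def)
  have finZ: "finite Z" unfolding Z_def
    by (rule finite_subset[OF Collect_restrict]) (simp add: finite_PiE)
  show ?thesis
  proof
    show "finite N" using finZ by (simp add: N_def)
    have "card N \<le> card ((\<lambda>z. vec n (\<lambda>i. h * of_int (z i))) ` Z)"
      using finZ by (intro card_mono) (auto simp only: N_def finite_imageI)
    also have "\<dots> \<le> card Z" using finZ by (rule card_image_le)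
    also have "\<dots> \<le> 2 ^ (4 * n) * 3 ^ n" unfolding Z_def by (rule card_integer_vectors_le)
    also have "\<dots> = 48 ^ n" by (simp add: power_mult flip: power_mult_distrib)
    finally show "card N \<le> 48 ^ n" .
    show "N \<subseteq> {a \<in> carrier_vec n. l2_norm a \<le> 1}"
    proof
      fix a assume "a \<in> N"
      then obtain z where "a = vec n (\<lambda>i. h * of_int (z i))" "l2_norm a \<le> 1"
        unfolding N_def by blast
      then show "a \<in> {a \<in> carrier_vec n. l2_norm a \<le> 1}" by simp
    qed
  next
    fix v assume v: "v \<in> carrier_vec n" "l2_norm v \<le> 1"
    from truncate_to_grid[OF v h] obtain z :: "nat \<Rightarrow> int" where z:
      "l2_norm (vec n (\<lambda>i. h * of_int (z i))) \<le> 1"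
      "l2_norm (v - vec n (\<lambda>i. h * of_int (z i))) \<le> h * sqrt (real n)"
      "h * (\<Sum>i<n. \<bar>of_int (z i)\<bar>) \<le> sqrt (real n)"
      "z \<in> extensional {..<n}" .
    have "(\<Sum>i<n. \<bar>of_int (z i) :: real\<bar>) = 4 * sqrt (real n) * (h * (\<Sum>i<n. \<bar>of_int (z i)\<bar>))"
    proof -
      have "4 * sqrt (real n) * h = 1"
        using n by (simp add: h_def)
      then show ?thesis by (simp flip: mult.assoc)
    qed
    also have "\<dots> \<le> 4 * sqrt (real n) * sqrt (real n)"
      using z(3) by (intro mult_left_mono) auto
    finally have "(\<Sum>i<n. \<bar>of_int (z i) :: real\<bar>) \<le> 4 * n"
      by (simp add: mult.assoc)
    then have "of_int (\<Sum>i<n. \<bar>z i\<bar>) \<le> (of_int (int (4 * n)) :: real)"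
      by simp
    then have s: "(\<Sum>i<n. \<bar>z i\<bar>) \<le> int (4 * n)"
      by (simp only: of_int_le_iff)
    have "z i \<in> {- int (4 * n)..int (4 * n)}" if "i < n" for i
    proof -
      have "\<bar>z i\<bar> \<le> (\<Sum>i<n. \<bar>z i\<bar>)"
        using that by (intro member_le_sum) auto
      then show ?thesis
        using s unfolding atLeastAtMost_iff by linarith
    qed
    then have "z \<in> Z"
      using z(4) s unfolding Z_def PiE_def Pi_def by blast
    then show "\<exists>a\<in>N. l2_norm (v - a) \<le> 1 / 4"
      using z(1,2) n unfolding N_def
      by (intro bexI[of _ "vec n (\<lambda>i. h * of_int (z i))"]) (simp_all add: h_def)
  qed
qed

text \<open>Rational vectors of the ball suffice to test a bound on the spectral norm. This makes events defined by such a
  bound measurable.\<close>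

lemma countable_spectral_norm_test:
  obtains D where "countable D" "D \<subseteq> carrier_vec n"
    "\<And>A c. dim_col A = n \<Longrightarrow> spectral_norm A \<le> c \<longleftrightarrow> (\<forall>v\<in>D. l2_norm (A *\<^sub>v v) \<le> c)"
proof -
  define D where "D = {a \<in> (\<lambda>(k, z). vec n (\<lambda>i. 1 / real (Suc k) * of_int (z i))) `
    (UNIV \<times> ({..<n} \<rightarrow>\<^sub>E (UNIV :: int set))). l2_norm a \<le> 1}"
  show ?thesis
  proof
    have "countable ((\<lambda>(k :: nat, z). vec n (\<lambda>i. 1 / real (Suc k) * of_int (z i))) `
      (UNIV \<times> ({..<n} \<rightarrow>\<^sub>E (UNIV :: int set))))"
      by (intro countable_image countable_SIGMA countable_PiE) auto
    then show "countable D"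
      unfolding D_def by (rule countable_subset[OF Collect_restrict])
    have D1: "l2_norm a \<le> 1" if "a \<in> D" for a
      using that unfolding D_def by blast
    show D: "D \<subseteq> carrier_vec n"
    proof
      fix a assume "a \<in> D"
      then obtain p where "a = (\<lambda>(k :: nat, z). vec n (\<lambda>i. 1 / real (Suc k) * of_int (z i))) p"
        unfolding D_def by blast
      then show "a \<in> carrier_vec n" by (simp add: case_prod_unfold)
    qed
    fix A :: "real mat" and c assume A: "dim_col A = n"
    show "spectral_norm A \<le> c \<longleftrightarrow> (\<forall>v\<in>D. l2_norm (A *\<^sub>v v) \<le> c)"
    proof
      assume "spectral_norm A \<le> c"
      then show "\<forall>v\<in>D. l2_norm (A *\<^sub>v v) \<le> c"
        using A D D1 by (auto simp: spectral_norm_le_iff)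
    next
      assume le: "\<forall>v\<in>D. l2_norm (A *\<^sub>v v) \<le> c"
      show "spectral_norm A \<le> c"
        unfolding spectral_norm_le_iff
      proof (intro ballI impI)
        fix v assume "v \<in> carrier_vec (dim_col A)" and v1: "l2_norm v \<le> 1"
        then have v: "v \<in> carrier_vec n" using A by simp
        have step: "l2_norm (A *\<^sub>v v) \<le> c + spectral_norm A * (1 / real (Suc k) * sqrt (real n))" for k
        proof -
          have "1 / real (Suc k) > 0" by simp
          from truncate_to_grid[OF v v1 this] obtain z :: "nat \<Rightarrow> int" where z:
            "l2_norm (vec n (\<lambda>i. 1 / real (Suc k) * of_int (z i))) \<le> 1"
            "l2_norm (v - vec n (\<lambda>i. 1 / real (Suc k) * of_int (z i))) \<le> 1 / real (Suc k) * sqrt (real n)"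
            "z \<in> extensional {..<n}" by blast
          define a where "a = vec n (\<lambda>i. 1 / real (Suc k) * of_int (z i))"
          have a: "a \<in> D"
          proof -
            have "(k, z) \<in> UNIV \<times> ({..<n} \<rightarrow>\<^sub>E UNIV)"
              using z(3) by (simp add: PiE_def)
            then have "a \<in> (\<lambda>(k, z). vec n (\<lambda>i. 1 / real (Suc k) * of_int (z i))) `
                (UNIV \<times> ({..<n} \<rightarrow>\<^sub>E UNIV))"
              unfolding a_def by (rule rev_image_eqI) simp
            then show ?thesis
              unfolding D_def using z(1) by (simp add: a_def)
          qed
          then have a': "a \<in> carrier_vec n" using D by auto
          have Ac: "A \<in> carrier_mat (dim_row A) n" using A by auto
          have "A *\<^sub>v v = A *\<^sub>v (a + (v - a))"
            using v a' by (intro arg_cong[where f="\<lambda>x. A *\<^sub>v x"]) auto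
          also have "\<dots> = A *\<^sub>v a + A *\<^sub>v (v - a)"
            using v a' by (intro mult_add_distrib_mat_vec[OF Ac]) auto
          finally have "l2_norm (A *\<^sub>v v) \<le> l2_norm (A *\<^sub>v a) + l2_norm (A *\<^sub>v (v - a))"
            using l2_norm_add_le[OF mult_mat_vec_carrier[OF Ac a'] mult_mat_vec_carrier[OF Ac, of "v - a"]]
              v a' by simp
          also have "l2_norm (A *\<^sub>v (v - a)) \<le> spectral_norm A * l2_norm (v - a)"
            using A v a' by (intro l2_norm_mult_le_spectral_norm) auto
          also have "\<dots> \<le> spectral_norm A * (1 / real (Suc k) * sqrt (real n))"
            using z(2) unfolding a_def by (rule mult_left_mono[OF _ spectral_norm_nonneg])
          finally show ?thesis using le[rule_format, OF a] by linarith
        qed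
        have "(\<lambda>k. c + spectral_norm A * (1 / real (Suc k) * sqrt (real n))) \<longlonglongrightarrow> 
            c + spectral_norm A * (0 * sqrt (real n))"
          by (intro tendsto_add tendsto_mult tendsto_const LIMSEQ_Suc[OF lim_1_over_n])
        then have "l2_norm (A *\<^sub>v v) \<le> c + spectral_norm A * (0 * sqrt (real n))"
          by (rule LIMSEQ_le_const) (use step in blast)
        then show "l2_norm (A *\<^sub>v v) \<le> c"
          by simp
      qed
    qed
  qed
qed

section \<open>Rotation invariance of Gaussian vectors\<close>

interpretation std_normal: real_distribution std_normal_distribution
  by (rule real_dist_normal_dist)

interpretation std_normal_prod: product_sigma_finite "\<lambda>_. std_normal_distribution"
  by unfold_locales

lemma sets_std_normal_cong [measurable_cong]: "sets std_normal_distribution = sets borel"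
  by simp

lemma prob_space_gaussian_vector: "prob_space (gaussian_vector d)"
  unfolding gaussian_vector_def by (intro prob_space_PiM std_normal.prob_space_axioms)

lemma nn_integral_std_normal_exp:
  "(\<integral>\<^sup>+x. ennreal (exp (c * x)) \<partial>std_normal_distribution) = ennreal (exp (c\<^sup>2 / 2))"
proof -
  have "std_normal_density x * exp (c * x) = exp (c\<^sup>2 / 2) * normal_density c 1 x" for x
    by (simp add: normal_density_def field_simps flip: exp_add)
      (simp add: power2_eq_square field_simps)
  then have "(\<integral>\<^sup>+x. ennreal (exp (c * x)) \<partial>std_normal_distribution)
    = (\<integral>\<^sup>+x. ennreal (exp (c\<^sup>2 / 2)) * ennreal (normal_density c 1 x) \<partial>lborel)"
    by (simp add: nn_integral_density flip: ennreal_mult)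
  also have "\<dots> = ennreal (exp (c\<^sup>2 / 2)) * (\<integral>\<^sup>+x. ennreal (normal_density c 1 x) \<partial>lborel)"
    by (rule nn_integral_cmult) simp
  also have "(\<integral>\<^sup>+x. ennreal (normal_density c 1 x) \<partial>lborel) = 1"
    by (subst nn_integral_eq_integral) (auto simp: integral_normal_density)
  finally show ?thesis by simp
qed

text \<open>The exponent \<open>1/4\<close> doubles the variance: times the standard normal density, the integrand is \<open>sqrt 2\<close>
  times the density of \<open>N(0, 2)\<close>.\<close>

lemma nn_integral_std_normal_exp_square:
  "(\<integral>\<^sup>+x. ennreal (exp (x\<^sup>2 / 4)) \<partial>std_normal_distribution) = ennreal (sqrt 2)"
proof -
  have "std_normal_density x * exp (x\<^sup>2 / 4) = sqrt 2 * normal_density 0 (sqrt 2) x" for x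
    by (simp add: normal_density_def field_simps real_sqrt_mult flip: exp_add)
  then have "(\<integral>\<^sup>+x. ennreal (exp (x\<^sup>2 / 4)) \<partial>std_normal_distribution)
    = (\<integral>\<^sup>+x. ennreal (sqrt 2) * ennreal (normal_density 0 (sqrt 2) x) \<partial>lborel)"
    by (simp add: nn_integral_density flip: ennreal_mult)
  also have "\<dots> = ennreal (sqrt 2) * (\<integral>\<^sup>+x. ennreal (normal_density 0 (sqrt 2) x) \<partial>lborel)"
    by (rule nn_integral_cmult) simp
  also have "(\<integral>\<^sup>+x. ennreal (normal_density 0 (sqrt 2) x) \<partial>lborel) = 1"
    by (subst nn_integral_eq_integral) (auto simp: integral_normal_density)
  finally show ?thesis by simp
qed

lemma nn_integral_std_normal_exp_abs: "(\<integral>\<^sup>+x. ennreal (exp (c * \<bar>x\<bar>)) \<partial>std_normal_distribution) < \<infinity>"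
proof -
  have "(\<integral>\<^sup>+x. ennreal (exp (c * \<bar>x\<bar>)) \<partial>std_normal_distribution)
    \<le> (\<integral>\<^sup>+x. ennreal (exp (c * x)) + ennreal (exp (- c * x)) \<partial>std_normal_distribution)"
    by (intro nn_integral_mono) (auto simp: abs_if simp flip: ennreal_plus intro: add_increasing)
  also have "\<dots> = ennreal (exp (c\<^sup>2 / 2)) + ennreal (exp ((- c)\<^sup>2 / 2))"
    by (subst nn_integral_add) (simp_all only: nn_integral_std_normal_exp, simp_all)
  also have "\<dots> < \<infinity>" by simp
  finally show ?thesis .
qed

text \<open>The joint density depends on \<open>x\<^sup>2 + y\<^sup>2\<close> only. Invariance of Lebesgue measure is obtained from two one-dimensional
  affine substitutions, one for each coordinate; the first one divides by \<open>c\<close>, which restricts the angle but is enough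
  for angles below \<open>\<pi>/2\<close>.\<close>

lemma nn_integral_std_normal_rotate:
  fixes f :: "real \<times> real \<Rightarrow> ennreal"
  assumes f [measurable]: "f \<in> borel_measurable (borel \<Otimes>\<^sub>M borel)"
    and cs: "c\<^sup>2 + s\<^sup>2 = 1" "c \<noteq> 0"
  shows "(\<integral>\<^sup>+p. f (c * fst p + s * snd p, c * snd p - s * fst p)
        \<partial>(std_normal_distribution \<Otimes>\<^sub>M std_normal_distribution))
      = (\<integral>\<^sup>+p. f p \<partial>(std_normal_distribution \<Otimes>\<^sub>M std_normal_distribution))"
proof -
  define \<phi> where "\<phi> x y = ennreal (std_normal_density x * std_normal_density y)" for x y
  define g where "g x y = \<phi> x y * f (x, y)" for x y
  have [measurable]: "(\<lambda>p. \<phi> (fst p) (snd p)) \<in> borel_measurable (borel \<Otimes>\<^sub>M borel)"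
    unfolding \<phi>_def by measurable
  have g [measurable]: "(\<lambda>p. g (fst p) (snd p)) \<in> borel_measurable (borel \<Otimes>\<^sub>M borel)"
    unfolding g_def by simp
  have g': "(\<lambda>x. g (a x) (b x)) \<in> borel_measurable M"
    if [measurable]: "a \<in> borel_measurable M" "b \<in> borel_measurable M" for a b :: "'x \<Rightarrow> real" and M
    using measurable_compose[OF measurable_Pair[OF that] g] by simp
  have lebesgue: "(\<integral>\<^sup>+p. h p \<partial>(std_normal_distribution \<Otimes>\<^sub>M std_normal_distribution))
      = (\<integral>\<^sup>+y. \<integral>\<^sup>+x. \<phi> x y * h (x, y) \<partial>lborel \<partial>lborel)"
    if [measurable]: "h \<in> borel_measurable (borel \<Otimes>\<^sub>M borel)" for h :: "real \<times> real \<Rightarrow> ennreal"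
  proof -
    interpret P: pair_sigma_finite std_normal_distribution std_normal_distribution ..
    have "(\<integral>\<^sup>+p. h p \<partial>(std_normal_distribution \<Otimes>\<^sub>M std_normal_distribution))
        = (\<integral>\<^sup>+y. \<integral>\<^sup>+x. h (x, y) \<partial>std_normal_distribution \<partial>std_normal_distribution)"
      by (subst P.nn_integral_snd[symmetric]) simp_all
    also have "\<dots> = (\<integral>\<^sup>+y. ennreal (std_normal_density y) * (\<integral>\<^sup>+x. ennreal (std_normal_density x) * h (x, y) \<partial>lborel) \<partial>lborel)"
      by (simp add: nn_integral_density)
    also have "\<dots> = (\<integral>\<^sup>+y. \<integral>\<^sup>+x. \<phi> x y * h (x, y) \<partial>lborel \<partial>lborel)"
      by (simp add: \<phi>_def ennreal_mult nn_integral_cmult[symmetric] mult_ac)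
    finally show ?thesis .
  qed
  have rot: "\<phi> (c * x + s * y) (c * y - s * x) = \<phi> x y" for x y
  proof -
    have "(c * x + s * y)\<^sup>2 + (c * y - s * x)\<^sup>2 = (c\<^sup>2 + s\<^sup>2) * (x\<^sup>2 + y\<^sup>2)"
      by (simp add: power2_eq_square algebra_simps)
    then have "(c * x + s * y)\<^sup>2 + (c * y - s * x)\<^sup>2 = x\<^sup>2 + y\<^sup>2"
      using cs by simp
    then have "exp (- (c * x + s * y)\<^sup>2 / 2) * exp (- (c * y - s * x)\<^sup>2 / 2) = exp (- x\<^sup>2 / 2) * exp (- y\<^sup>2 / 2)"
      by (simp flip: exp_add add_divide_distrib)
    then show ?thesis
      by (simp add: \<phi>_def normal_density_def)
  qed
  \<comment> \<open>substitute \<open>u = c x + s y\<close> in the inner integral, then \<open>v = (y - s u) / c\<close> in the outer one\<close>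
  have inner: "ennreal \<bar>c\<bar> * (\<integral>\<^sup>+x. g (c * x + s * y) (c * y - s * x) \<partial>lborel)
      = (\<integral>\<^sup>+u. g u (- s * u / c + (1 / c) * y) \<partial>lborel)" for y
  proof -
    have "- s * (s * y + c * x) / c + (1 / c) * y = c * y - s * x" for x
    proof -
      have "- s * (s * y + c * x) / c + (1 / c) * y = ((1 - s\<^sup>2) * y - s * c * x) / c"
        using cs by (simp add: field_simps power2_eq_square)
      also have "1 - s\<^sup>2 = c\<^sup>2" using cs by simp
      finally show ?thesis using cs by (simp add: field_simps power2_eq_square)
    qed
    then show ?thesis
      using cs by (subst (2) nn_integral_real_affine[where c=c and t="s * y"])
        (simp_all add: g' add.commute)
  qed
  have outer: "ennreal \<bar>c\<bar> * (\<integral>\<^sup>+v. g u v \<partial>lborel) = (\<integral>\<^sup>+y. g u (- s * u / c + (1 / c) * y) \<partial>lborel)" for u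
    using cs by (subst nn_integral_real_affine[where c="1 / c" and t="- s * u / c"])
      (simp_all add: g' mult.assoc[symmetric] flip: ennreal_mult)
  have "ennreal \<bar>c\<bar> * (\<integral>\<^sup>+p. f (c * fst p + s * snd p, c * snd p - s * fst p)
        \<partial>(std_normal_distribution \<Otimes>\<^sub>M std_normal_distribution))
      = (\<integral>\<^sup>+y. ennreal \<bar>c\<bar> * (\<integral>\<^sup>+x. g (c * x + s * y) (c * y - s * x) \<partial>lborel) \<partial>lborel)"
  proof -
    have "(\<lambda>y. \<integral>\<^sup>+x. g (c * x + s * y) (c * y - s * x) \<partial>lborel) \<in> borel_measurable lborel"
      by (rule lborel.borel_measurable_nn_integral) (simp add: case_prod_unfold g')
    then show ?thesis
      by (subst lebesgue) (simp_all add: nn_integral_cmult g_def rot)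
  qed
  also have "\<dots> = (\<integral>\<^sup>+y. \<integral>\<^sup>+u. g u (- s * u / c + (1 / c) * y) \<partial>lborel \<partial>lborel)"
    by (simp only: inner)
  also have "\<dots> = (\<integral>\<^sup>+u. \<integral>\<^sup>+y. g u (- s * u / c + (1 / c) * y) \<partial>lborel \<partial>lborel)"
    by (rule lborel_pair.Fubini') (simp add: case_prod_unfold g')
  also have "\<dots> = (\<integral>\<^sup>+u. ennreal \<bar>c\<bar> * (\<integral>\<^sup>+v. g u v \<partial>lborel) \<partial>lborel)"
    by (simp only: outer)
  also have "\<dots> = ennreal \<bar>c\<bar> * (\<integral>\<^sup>+u. \<integral>\<^sup>+v. g u v \<partial>lborel \<partial>lborel)"
    by (rule nn_integral_cmult) measurable
  also have "(\<integral>\<^sup>+u. \<integral>\<^sup>+v. g u v \<partial>lborel \<partial>lborel) = (\<integral>\<^sup>+v. \<integral>\<^sup>+u. g u v \<partial>lborel \<partial>lborel)"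
    by (rule lborel_pair.Fubini') (simp add: case_prod_unfold g')
  also have "\<dots> = (\<integral>\<^sup>+p. f p \<partial>(std_normal_distribution \<Otimes>\<^sub>M std_normal_distribution))"
    by (subst lebesgue) (simp_all add: g_def)
  finally show ?thesis
    using cs by (simp add: ennreal_mult_cancel_left)
qed

lemma nn_integral_distr':
  assumes "T \<in> measurable M N" "f \<in> borel_measurable N"
  shows "(\<integral>\<^sup>+x. f x \<partial>distr M N T) = (\<integral>\<^sup>+x. f (T x) \<partial>M)"
  using assms by (simp add: nn_integral_distr)

lemma emeasure_distr_eq_nn_integral:
  assumes "T \<in> measurable M N" "A \<in> sets N"
  shows "emeasure (distr M N T) A = (\<integral>\<^sup>+x. indicator A (T x) \<partial>M)"
proof -
  have "emeasure (distr M N T) A = (\<integral>\<^sup>+x. indicator A x \<partial>distr M N T)"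
    using assms by simp
  also have "\<dots> = (\<integral>\<^sup>+x. indicator A (T x) \<partial>M)"
    using assms by (intro nn_integral_distr') auto
  finally show ?thesis .
qed

text \<open>A pair of Gaussian vectors and a vector of Gaussian pairs have the same law. The second form is the one on which a
  rotation acts coordinatewise.\<close>

lemma distr_zip_pair_gaussian:
  assumes I: "finite I"
  shows "distr (Pi\<^sub>M I (\<lambda>_. std_normal_distribution) \<Otimes>\<^sub>M Pi\<^sub>M I (\<lambda>_. std_normal_distribution))
      (Pi\<^sub>M I (\<lambda>_. std_normal_distribution \<Otimes>\<^sub>M std_normal_distribution)) (\<lambda>p. \<lambda>i\<in>I. (fst p i, snd p i))
    = Pi\<^sub>M I (\<lambda>_. std_normal_distribution \<Otimes>\<^sub>M std_normal_distribution)"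
    (is "distr (?G \<Otimes>\<^sub>M ?G) ?P ?zip = _")
proof -
  let ?N = "std_normal_distribution"
  interpret G: prob_space ?G
    by (intro prob_space_PiM std_normal.prob_space_axioms)
  interpret GG: pair_prob_space ?G ?G ..
  interpret NN: pair_prob_space ?N ?N ..
  interpret P: product_sigma_finite "\<lambda>_. ?N \<Otimes>\<^sub>M ?N"
    by unfold_locales
  show ?thesis
  proof (rule P.PiM_eqI[OF I])
    fix A :: "'a \<Rightarrow> (real \<times> real) set"
    assume A: "\<And>i. i \<in> I \<Longrightarrow> A i \<in> sets (?N \<Otimes>\<^sub>M ?N)"
    have zip: "?zip \<in> measurable (?G \<Otimes>\<^sub>M ?G) ?P"
      by measurable
    have set: "Pi\<^sub>E I A \<in> sets ?P"
      using I A by (intro sets_PiM_I_finite) auto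
    define h :: "'a \<Rightarrow> real \<times> real \<Rightarrow> ennreal" where "h i = indicator (A i)" for i
    have NN: "sets (?N \<Otimes>\<^sub>M ?N) = sets (borel \<Otimes>\<^sub>M borel)"
      by (rule sets_pair_measure_cong) simp_all
    have h: "(\<lambda>z. h i (a z, b z)) \<in> borel_measurable M"
      if "i \<in> I" and [measurable]: "a \<in> borel_measurable M" "b \<in> borel_measurable M" for i a b M
    proof -
      have "h i \<in> borel_measurable (borel \<Otimes>\<^sub>M borel)"
        using A[OF \<open>i \<in> I\<close>] NN unfolding h_def by (intro borel_measurable_indicator) simp
      from measurable_compose[OF measurable_Pair[OF that(2,3)] this] show ?thesis .
    qed
    have comp: "(\<lambda>x. x i) \<in> borel_measurable ?G" if "i \<in> I" for i
      using that by measurable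
    have "emeasure (distr (?G \<Otimes>\<^sub>M ?G) ?P ?zip) (Pi\<^sub>E I A)
        = (\<integral>\<^sup>+p. indicator (Pi\<^sub>E I A) (?zip p) \<partial>(?G \<Otimes>\<^sub>M ?G))"
      by (rule emeasure_distr_eq_nn_integral[OF zip set])
    also have "\<dots> = (\<integral>\<^sup>+p. (\<Prod>i\<in>I. h i (fst p i, snd p i)) \<partial>(?G \<Otimes>\<^sub>M ?G))"
      using I by (intro nn_integral_cong) (auto simp: h_def indicator_def PiE_iff prod.neutral)
    also have "\<dots> = (\<integral>\<^sup>+x. \<integral>\<^sup>+y. (\<Prod>i\<in>I. h i (x i, y i)) \<partial>?G \<partial>?G)"
    proof (subst G.nn_integral_fst[symmetric])
      show "(\<lambda>p. \<Prod>i\<in>I. h i (fst p i, snd p i)) \<in> borel_measurable (?G \<Otimes>\<^sub>M ?G)"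
        by (intro borel_measurable_prod_ennreal h measurable_compose[OF measurable_fst comp]
            measurable_compose[OF measurable_snd comp])
    qed simp
    also have "\<dots> = (\<integral>\<^sup>+x. (\<Prod>i\<in>I. \<integral>\<^sup>+y. h i (x i, y) \<partial>?N) \<partial>?G)"
      by (intro nn_integral_cong std_normal_prod.product_nn_integral_prod[OF I] h) simp_all
    also have "\<dots> = (\<Prod>i\<in>I. \<integral>\<^sup>+x. \<integral>\<^sup>+y. h i (x, y) \<partial>?N \<partial>?N)"
    proof (intro std_normal_prod.product_nn_integral_prod[OF I])
      fix i assume "i \<in> I"
      then have "h i \<in> borel_measurable (?N \<Otimes>\<^sub>M ?N)"
        using A unfolding h_def by (intro borel_measurable_indicator)
      then show "(\<lambda>x. \<integral>\<^sup>+y. h i (x, y) \<partial>?N) \<in> borel_measurable ?N"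
        by (intro std_normal.borel_measurable_nn_integral) (simp add: case_prod_unfold)
    qed
    also have "\<dots> = (\<Prod>i\<in>I. emeasure (?N \<Otimes>\<^sub>M ?N) (A i))"
    proof (intro prod.cong refl)
      fix i assume i: "i \<in> I"
      have "(\<integral>\<^sup>+x. \<integral>\<^sup>+y. h i (x, y) \<partial>?N \<partial>?N) = (\<integral>\<^sup>+p. h i p \<partial>(?N \<Otimes>\<^sub>M ?N))"
        using A[OF i] unfolding h_def by (intro std_normal.nn_integral_fst borel_measurable_indicator)
      also have "\<dots> = emeasure (?N \<Otimes>\<^sub>M ?N) (A i)"
        using A[OF i] unfolding h_def by (rule nn_integral_indicator)
      finally show "(\<integral>\<^sup>+x. \<integral>\<^sup>+y. h i (x, y) \<partial>?N \<partial>?N) = emeasure (?N \<Otimes>\<^sub>M ?N) (A i)" .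
    qed
    finally show "emeasure (distr (?G \<Otimes>\<^sub>M ?G) ?P ?zip) (Pi\<^sub>E I A)
      = (\<Prod>i\<in>I. emeasure (?N \<Otimes>\<^sub>M ?N) (A i))" .
  qed simp
qed

lemma nn_integral_gaussian_vector_rotate:
  assumes f: "f \<in> borel_measurable (gaussian_vector d \<Otimes>\<^sub>M gaussian_vector d)"
    and cs: "c\<^sup>2 + s\<^sup>2 = 1" "c \<noteq> 0"
  shows "(\<integral>\<^sup>+p. f (\<lambda>i\<in>{..<d}. c * fst p i + s * snd p i, \<lambda>i\<in>{..<d}. c * snd p i - s * fst p i)
        \<partial>(gaussian_vector d \<Otimes>\<^sub>M gaussian_vector d))
      = (\<integral>\<^sup>+p. f p \<partial>(gaussian_vector d \<Otimes>\<^sub>M gaussian_vector d))"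
proof -
  let ?N = "std_normal_distribution"
  let ?G = "gaussian_vector d"
  let ?P = "Pi\<^sub>M {..<d} (\<lambda>_. ?N \<Otimes>\<^sub>M ?N)"
  interpret NN: pair_prob_space ?N ?N ..
  define zip where "zip p = (\<lambda>i\<in>{..<d}. (fst p i, snd p i))" for p :: "(nat \<Rightarrow> real) \<times> (nat \<Rightarrow> real)"
  define unzip where "unzip \<omega> = (\<lambda>i\<in>{..<d}. fst (\<omega> i), \<lambda>i\<in>{..<d}. snd (\<omega> i))" for \<omega> :: "nat \<Rightarrow> real \<times> real"
  define r where "r p = (c * fst p + s * snd p, c * snd p - s * fst p)" for p :: "real \<times> real"
  have NN: "sets (?N \<Otimes>\<^sub>M ?N) = sets (borel \<Otimes>\<^sub>M borel)"
    by (rule sets_pair_measure_cong) simp_all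
  have zip: "zip \<in> measurable (?G \<Otimes>\<^sub>M ?G) ?P"
    unfolding zip_def gaussian_vector_def by measurable
  have unzip: "unzip \<in> measurable ?P (?G \<Otimes>\<^sub>M ?G)"
    unfolding unzip_def gaussian_vector_def by measurable
  have r: "r \<in> measurable (?N \<Otimes>\<^sub>M ?N) (?N \<Otimes>\<^sub>M ?N)"
    unfolding r_def by measurable
  have distr_zip: "distr (?G \<Otimes>\<^sub>M ?G) ?P zip = ?P"
    unfolding zip_def gaussian_vector_def by (rule distr_zip_pair_gaussian) simp
  have distr_r: "distr (?N \<Otimes>\<^sub>M ?N) (?N \<Otimes>\<^sub>M ?N) r = ?N \<Otimes>\<^sub>M ?N"
  proof (rule measure_eqI)
    fix A assume "A \<in> sets (distr (?N \<Otimes>\<^sub>M ?N) (?N \<Otimes>\<^sub>M ?N) r)"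
    then have A: "A \<in> sets (?N \<Otimes>\<^sub>M ?N)" by simp
    have "emeasure (distr (?N \<Otimes>\<^sub>M ?N) (?N \<Otimes>\<^sub>M ?N) r) A = (\<integral>\<^sup>+p. indicator A (r p) \<partial>(?N \<Otimes>\<^sub>M ?N))"
      by (rule emeasure_distr_eq_nn_integral[OF r A])
    also have "\<dots> = (\<integral>\<^sup>+p. indicator A p \<partial>(?N \<Otimes>\<^sub>M ?N))"
      unfolding r_def using A NN cs by (intro nn_integral_std_normal_rotate borel_measurable_indicator) simp_all
    also have "\<dots> = emeasure (?N \<Otimes>\<^sub>M ?N) A"
      using A by (rule nn_integral_indicator)
    finally show "emeasure (distr (?N \<Otimes>\<^sub>M ?N) (?N \<Otimes>\<^sub>M ?N) r) A = emeasure (?N \<Otimes>\<^sub>M ?N) A" .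
  qed simp
  have compose: "compose {..<d} r \<in> measurable ?P ?P"
    unfolding compose_def using r by measurable
  have distr_compose: "distr ?P ?P (compose {..<d} r) = ?P"
    using distr_PiM_finite_prob_space'[of "{..<d}" "\<lambda>_. ?N \<Otimes>\<^sub>M ?N" "\<lambda>_. ?N \<Otimes>\<^sub>M ?N" r] r
    by (simp add: distr_r NN.prob_space_axioms)
  have f': "(\<lambda>\<omega>. f (unzip \<omega>)) \<in> borel_measurable ?P"
    by (rule measurable_compose[OF unzip f])
  have unzip_zip: "unzip (zip p) = p" if "p \<in> space (?G \<Otimes>\<^sub>M ?G)" for p
    using that unfolding unzip_def zip_def gaussian_vector_def
    by (auto simp: space_pair_measure space_PiM PiE_def extensional_restrict cong: restrict_cong)
  have unzip_r: "unzip (compose {..<d} r (zip p))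
      = (\<lambda>i\<in>{..<d}. c * fst p i + s * snd p i, \<lambda>i\<in>{..<d}. c * snd p i - s * fst p i)" for p
    unfolding unzip_def zip_def compose_def r_def by auto
  have "(\<integral>\<^sup>+p. f (unzip (compose {..<d} r (zip p))) \<partial>(?G \<Otimes>\<^sub>M ?G))
      = (\<integral>\<^sup>+\<omega>. f (unzip (compose {..<d} r \<omega>)) \<partial>?P)"
    using nn_integral_distr'[OF zip measurable_compose[OF compose f']] by (simp only: distr_zip)
  also have "\<dots> = (\<integral>\<^sup>+\<omega>. f (unzip \<omega>) \<partial>?P)"
    using nn_integral_distr'[OF compose f'] by (simp only: distr_compose)
  also have "\<dots> = (\<integral>\<^sup>+p. f (unzip (zip p)) \<partial>(?G \<Otimes>\<^sub>M ?G))"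
    using nn_integral_distr'[OF zip f'] by (simp only: distr_zip)
  also have "\<dots> = (\<integral>\<^sup>+p. f p \<partial>(?G \<Otimes>\<^sub>M ?G))"
    by (intro nn_integral_cong) (simp add: unzip_zip)
  finally show ?thesis
    by (simp only: unzip_r)
qed

section \<open>The Maurey--Pisier inequality\<close>

lemma sets_gaussian_vector [measurable_cong]:
  "sets (gaussian_vector d) = sets (Pi\<^sub>M {..<d} (\<lambda>_. borel))"
  unfolding gaussian_vector_def by (intro sets_PiM_cong) simp_all

lemma measurable_gaussian_vector_component [measurable]:
  "j \<in> {..<d} \<Longrightarrow> (\<lambda>w. w j) \<in> borel_measurable (gaussian_vector d)"
  by (subst measurable_cong_sets[OF sets_gaussian_vector refl]) (rule measurable_component_singleton)

lemma nn_integral_gaussian_vector_prod: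
  assumes "\<And>j. j < d \<Longrightarrow> f j \<in> borel_measurable borel"
  shows "(\<integral>\<^sup>+w. (\<Prod>j<d. f j (w j)) \<partial>gaussian_vector d) = (\<Prod>j<d. \<integral>\<^sup>+x. f j x \<partial>std_normal_distribution)"
  unfolding gaussian_vector_def
  using assms by (intro std_normal_prod.product_nn_integral_prod) simp_all

lemma nn_integral_gaussian_vector_exp_linear:
  "(\<integral>\<^sup>+w. ennreal (exp (\<Sum>j<d. g j * w j)) \<partial>gaussian_vector d) = ennreal (exp ((\<Sum>j<d. (g j)\<^sup>2) / 2))"
proof -
  have "(\<integral>\<^sup>+w. ennreal (exp (\<Sum>j<d. g j * w j)) \<partial>gaussian_vector d)
      = (\<integral>\<^sup>+w. (\<Prod>j<d. ennreal (exp (g j * w j))) \<partial>gaussian_vector d)"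
    by (simp add: exp_sum prod_ennreal)
  also have "\<dots> = (\<Prod>j<d. ennreal (exp ((g j)\<^sup>2 / 2)))"
    by (subst nn_integral_gaussian_vector_prod) (simp_all add: nn_integral_std_normal_exp)
  also have "\<dots> = ennreal (exp ((\<Sum>j<d. (g j)\<^sup>2) / 2))"
    by (simp add: prod_ennreal exp_sum sum_divide_distrib)
  finally show ?thesis .
qed

lemma nn_integral_gaussian_vector_exp_abs:
  "(\<integral>\<^sup>+w. ennreal (exp (c * (\<Sum>j<d. \<bar>w j\<bar>))) \<partial>gaussian_vector d) < \<infinity>"
proof -
  have "(\<integral>\<^sup>+w. ennreal (exp (c * (\<Sum>j<d. \<bar>w j\<bar>))) \<partial>gaussian_vector d)
      = (\<integral>\<^sup>+w. (\<Prod>j<d. ennreal (exp (c * \<bar>w j\<bar>))) \<partial>gaussian_vector d)"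
    by (simp add: exp_sum prod_ennreal sum_distrib_left)
  also have "\<dots> = (\<Prod>j<d. \<integral>\<^sup>+x. ennreal (exp (c * \<bar>x\<bar>)) \<partial>std_normal_distribution)"
    by (rule nn_integral_gaussian_vector_prod) simp
  also have "\<dots> < \<infinity>"
    using nn_integral_std_normal_exp_abs[of c]
    by (simp add: less_top[symmetric] ennreal_prod_eq_top del: prod_constant)
  finally show ?thesis .
qed

lemma nn_integral_gaussian_pair_exp_abs:
  "(\<integral>\<^sup>+p. ennreal (exp (c * (\<Sum>j<d. \<bar>fst p j\<bar> + \<bar>snd p j\<bar>)))
     \<partial>(gaussian_vector d \<Otimes>\<^sub>M gaussian_vector d)) < \<infinity>"
proof -
  interpret G: prob_space "gaussian_vector d" by (rule prob_space_gaussian_vector)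
  let ?e = "\<lambda>w. ennreal (exp (c * (\<Sum>j<d. \<bar>w j\<bar>)))"
  have "(\<integral>\<^sup>+p. ennreal (exp (c * (\<Sum>j<d. \<bar>fst p j\<bar> + \<bar>snd p j\<bar>)))
     \<partial>(gaussian_vector d \<Otimes>\<^sub>M gaussian_vector d))
    = (\<integral>\<^sup>+p. ?e (fst p) * ?e (snd p) \<partial>(gaussian_vector d \<Otimes>\<^sub>M gaussian_vector d))"
    by (simp add: sum.distrib distrib_left exp_add ennreal_mult)
  also have "\<dots> = (\<integral>\<^sup>+x. \<integral>\<^sup>+y. ?e x * ?e y \<partial>gaussian_vector d \<partial>gaussian_vector d)"
    by (subst G.nn_integral_fst[symmetric]) simp_all
  also have "\<dots> = (\<integral>\<^sup>+x. ?e x \<partial>gaussian_vector d) * (\<integral>\<^sup>+y. ?e y \<partial>gaussian_vector d)"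
    by (simp add: nn_integral_cmult nn_integral_multc)
  also have "\<dots> < \<infinity>"
    using nn_integral_gaussian_vector_exp_abs[where c = c and d = d] by (simp add: ennreal_mult_less_top)
  finally show ?thesis .
qed

lemma abs_cos_minus_one_le: "\<bar>cos x - 1\<bar> \<le> \<bar>x\<bar>" for x :: real
proof -
  have "\<bar>cos x - 1\<bar> = 2 * (\<bar>sin (x / 2)\<bar> * \<bar>sin (x / 2)\<bar>)"
    using cos_double_sin[of "x / 2"] by (simp add: power2_eq_square abs_mult[symmetric])
  also have "\<dots> \<le> 2 * (\<bar>x / 2\<bar> * 1)"
    by (intro mult_left_mono mult_mono abs_sin_le_one abs_sin_x_le_abs_x) auto
  finally show ?thesis by simp
qed

lemma exp_sum_le_average:
  fixes b :: "nat \<Rightarrow> real"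
  assumes N: "N \<ge> 1"
  shows "exp (\<Sum>j<N. b j) \<le> (\<Sum>j<N. 1 / real N * exp (real N * b j))"
proof -
  have "exp (\<Sum>j<N. (1 / real N) *\<^sub>R (real N * b j)) \<le> (\<Sum>j<N. 1 / real N * exp (real N * b j))"
  proof (rule convex_on_sum[of "{..<N}" UNIV exp])
    show "convex_on UNIV (exp :: real \<Rightarrow> real)" by (rule exp_convex)
    show "{..<N} \<noteq> {}" using N by (auto simp: lessThan_empty_iff)
  qed (use N in auto)
  then show ?thesis using N by simp
qed

text \<open>Along the arc from \<open>fst p\<close> to \<open>snd p\<close>, divided into \<open>N + 1\<close> equal steps, the increments of \<open>F\<close> are the values of
  one function at rotated copies of \<open>p\<close>, so Jensen's inequality bounds the left-hand side by the integral \<open>h N\<close> of a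
  single step. Letting \<open>N\<close> tend to infinity linearizes that step; the Lipschitz bound with respect to the \<open>l1\<close> norm, with
  an arbitrary constant \<open>K\<close>, provides the dominating function.\<close>

lemma maurey_pisier_smooth:
  fixes F :: "(nat \<Rightarrow> real) \<Rightarrow> real" and G :: "(nat \<Rightarrow> real) \<Rightarrow> nat \<Rightarrow> real"
  assumes F [measurable]: "F \<in> borel_measurable (gaussian_vector d)"
    and Lip: "\<And>x y. \<bar>F x - F y\<bar> \<le> K * (\<Sum>j<d. \<bar>x j - y j\<bar>)"
    and deriv: "\<And>x y. ((\<lambda>h. F (\<lambda>j. cos h * x j + sin h * y j)) has_real_derivative (\<Sum>j<d. G x j * y j)) (at 0)"
    and grad: "\<And>x. (\<Sum>j<d. (G x j)\<^sup>2) \<le> L\<^sup>2"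
  shows "(\<integral>\<^sup>+p. ennreal (exp (t * (F (snd p) - F (fst p)))) \<partial>(gaussian_vector d \<Otimes>\<^sub>M gaussian_vector d))
    \<le> ennreal (exp (t\<^sup>2 * pi\<^sup>2 * L\<^sup>2 / 8))"
proof -
  let ?G = "gaussian_vector d"
  interpret G: prob_space ?G by (rule prob_space_gaussian_vector)
  \<comment> \<open>values outside the first \<open>d\<close> coordinates are irrelevant, so restrictions can be dropped\<close>
  have F_cong: "F x = F y" if "\<And>j. j < d \<Longrightarrow> x j = y j" for x y
    using Lip[of x y] that by simp
  define arc where "arc a p j = cos a * fst p j + sin a * snd p j"
    for a :: real and p :: "(nat \<Rightarrow> real) \<times> (nat \<Rightarrow> real)" and j
  have arc_meas: "(\<lambda>p. F (arc a p)) \<in> borel_measurable (?G \<Otimes>\<^sub>M ?G)" for a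
  proof -
    have "(\<lambda>p. \<lambda>j\<in>{..<d}. arc a p j) \<in> measurable (?G \<Otimes>\<^sub>M ?G) (Pi\<^sub>M {..<d} (\<lambda>_. borel))"
      unfolding arc_def by measurable
    then have "(\<lambda>p. \<lambda>j\<in>{..<d}. arc a p j) \<in> measurable (?G \<Otimes>\<^sub>M ?G) ?G"
      by (simp cong: measurable_cong_sets add: sets_gaussian_vector)
    from measurable_compose[OF this F] show ?thesis
      by (rule measurable_cong[THEN iffD1, rotated]) (auto intro!: F_cong)
  qed
  define \<delta> where "\<delta> N = pi / 2 / real (Suc N)" for N
  \<comment> \<open>the exponential of the first increment, scaled by the number \<open>N + 1\<close> of steps as convexity demands\<close>
  define h where "h N p = exp (t * (real (Suc N) * (F (arc (\<delta> N) p) - F (fst p))))" for N p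
  have fst_meas [measurable]: "(\<lambda>p. F (fst p)) \<in> borel_measurable (?G \<Otimes>\<^sub>M ?G)"
    by measurable
  have h_meas [measurable]: "h N \<in> borel_measurable (?G \<Otimes>\<^sub>M ?G)" for N
    unfolding h_def using arc_meas[of "\<delta> N"] by simp
  define w where "w p = exp (\<bar>t\<bar> * K * pi / 2 * (\<Sum>j<d. \<bar>fst p j\<bar> + \<bar>snd p j\<bar>))"
    for p :: "(nat \<Rightarrow> real) \<times> (nat \<Rightarrow> real)"
  have K: "0 \<le> K" if "d > 0"
  proof -
    have "0 \<le> K * (\<Sum>j<d. \<bar>1 - 0\<bar>)"
      by (rule order.trans[OF abs_ge_zero Lip])
    then show ?thesis using that by (simp add: zero_le_mult_iff)
  qed
  have bound: "h N p \<le> w p" for N p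
  proof (cases "d = 0")
    case True
    then have "F (arc (\<delta> N) p) = F (fst p)" by (intro F_cong) simp
    then show ?thesis using True by (simp add: h_def w_def)
  next
    case False
    then have K0: "0 \<le> K" using K by simp
    have "\<bar>F (arc (\<delta> N) p) - F (fst p)\<bar> \<le> K * (\<Sum>j<d. \<bar>arc (\<delta> N) p j - fst p j\<bar>)"
      by (rule Lip)
    also have "\<dots> \<le> K * (\<Sum>j<d. \<delta> N * (\<bar>fst p j\<bar> + \<bar>snd p j\<bar>))"
    proof (intro mult_left_mono sum_mono K0)
      fix j
      have "\<bar>arc (\<delta> N) p j - fst p j\<bar> = \<bar>(cos (\<delta> N) - 1) * fst p j + sin (\<delta> N) * snd p j\<bar>"
        by (simp add: arc_def algebra_simps)
      also have "\<dots> \<le> \<bar>cos (\<delta> N) - 1\<bar> * \<bar>fst p j\<bar> + \<bar>sin (\<delta> N)\<bar> * \<bar>snd p j\<bar>"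
        unfolding abs_mult[symmetric] by (rule abs_triangle_ineq)
      also have "\<dots> \<le> \<bar>\<delta> N\<bar> * \<bar>fst p j\<bar> + \<bar>\<delta> N\<bar> * \<bar>snd p j\<bar>"
        by (intro add_mono mult_right_mono abs_cos_minus_one_le abs_sin_x_le_abs_x) auto
      finally show "\<bar>arc (\<delta> N) p j - fst p j\<bar> \<le> \<delta> N * (\<bar>fst p j\<bar> + \<bar>snd p j\<bar>)"
        by (simp add: \<delta>_def distrib_left)
    qed
    also have "\<dots> = K * \<delta> N * (\<Sum>j<d. \<bar>fst p j\<bar> + \<bar>snd p j\<bar>)"
      by (simp add: sum_distrib_left mult.assoc)
    finally have F_le: "\<bar>F (arc (\<delta> N) p) - F (fst p)\<bar> \<le> K * \<delta> N * (\<Sum>j<d. \<bar>fst p j\<bar> + \<bar>snd p j\<bar>)" .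
    have "t * (real (Suc N) * (F (arc (\<delta> N) p) - F (fst p)))
        \<le> \<bar>t\<bar> * (real (Suc N) * \<bar>F (arc (\<delta> N) p) - F (fst p)\<bar>)"
      by (rule order.trans[OF abs_ge_self]) (simp add: abs_mult)
    also have "\<dots> \<le> \<bar>t\<bar> * (real (Suc N) * (K * \<delta> N * (\<Sum>j<d. \<bar>fst p j\<bar> + \<bar>snd p j\<bar>)))"
      by (intro mult_left_mono F_le) auto
    also have "\<dots> = \<bar>t\<bar> * K * pi / 2 * (\<Sum>j<d. \<bar>fst p j\<bar> + \<bar>snd p j\<bar>)"
      by (simp add: \<delta>_def field_simps)
    finally show ?thesis by (simp add: h_def w_def)
  qed
  define lin where "lin p = exp (t * (pi / 2 * (\<Sum>j<d. G (fst p) j * snd p j)))" for p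
  have lim: "(\<lambda>N. h N p) \<longlonglongrightarrow> lin p" for p
  proof -
    have \<delta>0: "filterlim \<delta> (at 0) sequentially"
    proof -
      have "(\<lambda>N. pi / 2 * (1 / real (Suc N))) \<longlonglongrightarrow> pi / 2 * 0"
        by (intro tendsto_mult tendsto_const LIMSEQ_Suc[OF lim_1_over_n])
      then have "\<delta> \<longlonglongrightarrow> 0" by (simp add: \<delta>_def[abs_def])
      then show ?thesis by (auto simp: filterlim_at \<delta>_def)
    qed
    have "((\<lambda>a. (F (arc a p) - F (arc 0 p)) / a) \<longlongrightarrow> (\<Sum>j<d. G (fst p) j * snd p j)) (at 0)"
      using deriv[of "fst p" "snd p"] unfolding has_field_derivative_iff arc_def[abs_def] by simp
    from filterlim_compose[OF this \<delta>0]
    have "(\<lambda>N. pi / 2 * ((F (arc (\<delta> N) p) - F (arc 0 p)) / \<delta> N)) \<longlonglongrightarrow> pi / 2 * (\<Sum>j<d. G (fst p) j * snd p j)"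
      by (intro tendsto_mult tendsto_const) (simp add: o_def)
    moreover have "pi / 2 * ((F (arc (\<delta> N) p) - F (arc 0 p)) / \<delta> N) = real (Suc N) * (F (arc (\<delta> N) p) - F (fst p))" for N
    proof -
      have "F (arc 0 p) = F (fst p)" by (intro F_cong) (simp add: arc_def)
      then show ?thesis by (simp add: \<delta>_def field_simps)
    qed
    ultimately have "(\<lambda>N. real (Suc N) * (F (arc (\<delta> N) p) - F (fst p))) \<longlonglongrightarrow> pi / 2 * (\<Sum>j<d. G (fst p) j * snd p j)"
      by (simp only:)
    from tendsto_exp[OF tendsto_mult[OF tendsto_const this]] show ?thesis
      unfolding h_def lin_def .
  qed
  \<comment> \<open>rotating by \<open>j \<delta>\<close> moves the first step of the arc to the \<open>j\<close>-th one; all angles used are below \<open>\<pi>/2\<close>\<close>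
  have step: "(\<integral>\<^sup>+p. ennreal (exp (t * (F (snd p) - F (fst p)))) \<partial>(?G \<Otimes>\<^sub>M ?G))
      \<le> (\<integral>\<^sup>+p. ennreal (h N p) \<partial>(?G \<Otimes>\<^sub>M ?G))" for N
  proof -
    let ?M = "Suc N"
    define rot where "rot j p = (\<lambda>i\<in>{..<d}. cos (real j * \<delta> N) * fst p i + sin (real j * \<delta> N) * snd p i,
      \<lambda>i\<in>{..<d}. cos (real j * \<delta> N) * snd p i - sin (real j * \<delta> N) * fst p i)"
      for j :: nat and p :: "(nat \<Rightarrow> real) \<times> (nat \<Rightarrow> real)"
    have inc: "h N (rot j p) = exp (real ?M * (t * (F (arc (real (Suc j) * \<delta> N) p) - F (arc (real j * \<delta> N) p))))" for j p
    proof -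
      have "F (arc (\<delta> N) (rot j p)) = F (arc (real (Suc j) * \<delta> N) p)"
      proof (rule F_cong)
        fix i assume "i < d"
        have "real (Suc j) * \<delta> N = \<delta> N + real j * \<delta> N" by (simp add: algebra_simps)
        then show "arc (\<delta> N) (rot j p) i = arc (real (Suc j) * \<delta> N) p i"
          using \<open>i < d\<close> by (simp only: arc_def rot_def cos_add sin_add) (simp add: algebra_simps)
      qed
      moreover have "F (fst (rot j p)) = F (arc (real j * \<delta> N) p)"
        by (rule F_cong) (simp add: rot_def arc_def)
      ultimately show ?thesis by (simp add: h_def mult_ac)
    qed
    have rot_meas: "rot j \<in> measurable (?G \<Otimes>\<^sub>M ?G) (?G \<Otimes>\<^sub>M ?G)" for j
    proof -
      have "rot j \<in> measurable (?G \<Otimes>\<^sub>M ?G) (Pi\<^sub>M {..<d} (\<lambda>_. borel) \<Otimes>\<^sub>M Pi\<^sub>M {..<d} (\<lambda>_. borel))"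
        unfolding rot_def by measurable
      then show ?thesis
        by (simp cong: measurable_cong_sets sets_pair_measure_cong add: sets_gaussian_vector)
    qed
    have tele: "t * (F (snd p) - F (fst p)) =
        (\<Sum>j<?M. t * (F (arc (real (Suc j) * \<delta> N) p) - F (arc (real j * \<delta> N) p)))" for p
    proof -
      have "F (arc (real ?M * \<delta> N) p) = F (snd p)"
        by (intro F_cong) (simp add: arc_def \<delta>_def del: of_nat_Suc)
      moreover have "F (arc (real 0 * \<delta> N) p) = F (fst p)"
        by (intro F_cong) (simp add: arc_def)
      moreover have "(\<Sum>j<?M. F (arc (real (Suc j) * \<delta> N) p) - F (arc (real j * \<delta> N) p))
          = F (arc (real ?M * \<delta> N) p) - F (arc (real 0 * \<delta> N) p)"
        by (rule sum_lessThan_telescope)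
      ultimately show ?thesis
        by (simp only: sum_distrib_left[symmetric])
    qed
    have "(\<integral>\<^sup>+p. ennreal (exp (t * (F (snd p) - F (fst p)))) \<partial>(?G \<Otimes>\<^sub>M ?G))
        \<le> (\<integral>\<^sup>+p. (\<Sum>j<?M. ennreal (1 / real ?M) * ennreal (h N (rot j p))) \<partial>(?G \<Otimes>\<^sub>M ?G))"
    proof (rule nn_integral_mono)
      fix p
      have "exp (t * (F (snd p) - F (fst p))) \<le> (\<Sum>j<?M. 1 / real ?M * h N (rot j p))"
        unfolding tele inc by (rule exp_sum_le_average) simp
      then have "ennreal (exp (t * (F (snd p) - F (fst p)))) \<le> ennreal (\<Sum>j<?M. 1 / real ?M * h N (rot j p))"
        by (rule ennreal_leI)
      also have "\<dots> = (\<Sum>j<?M. ennreal (1 / real ?M) * ennreal (h N (rot j p)))"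
        by (simp add: ennreal_mult[symmetric] h_def sum_ennreal del: sum.lessThan_Suc of_nat_Suc)
      finally show "ennreal (exp (t * (F (snd p) - F (fst p)))) \<le> \<dots>" .
    qed
    also have "\<dots> = (\<Sum>j<?M. ennreal (1 / real ?M) * (\<integral>\<^sup>+p. ennreal (h N (rot j p)) \<partial>(?G \<Otimes>\<^sub>M ?G)))"
      using measurable_compose[OF rot_meas h_meas]
      by (subst nn_integral_sum) (simp_all add: nn_integral_cmult del: sum.lessThan_Suc of_nat_Suc)
    also have "\<dots> = (\<Sum>j<?M. ennreal (1 / real ?M) * (\<integral>\<^sup>+p. ennreal (h N p) \<partial>(?G \<Otimes>\<^sub>M ?G)))"
    proof (intro sum.cong refl arg_cong[where f="\<lambda>x. ennreal (1 / real ?M) * x"])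
      fix j assume "j \<in> {..<?M}"
      then have "pi / 2 * (real j / real ?M) < pi / 2 * 1"
        by (intro mult_strict_left_mono) auto
      then have "real j * \<delta> N < pi / 2" "0 \<le> real j * \<delta> N"
        by (auto simp: \<delta>_def mult_ac)
      then have "cos (real j * \<delta> N) > 0"
        by (intro cos_gt_zero_pi) auto
      then show "(\<integral>\<^sup>+p. ennreal (h N (rot j p)) \<partial>(?G \<Otimes>\<^sub>M ?G)) = (\<integral>\<^sup>+p. ennreal (h N p) \<partial>(?G \<Otimes>\<^sub>M ?G))"
        unfolding rot_def using nn_integral_gaussian_vector_rotate[of "\<lambda>p. ennreal (h N p)" d] by simp
    qed
    also have "\<dots> = (\<integral>\<^sup>+p. ennreal (h N p) \<partial>(?G \<Otimes>\<^sub>M ?G))"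
    proof -
      have "of_nat ?M * ennreal (1 / real ?M) = 1"
        by (simp add: ennreal_of_nat_eq_real_of_nat ennreal_mult[symmetric] del: of_nat_Suc)
      then show ?thesis
        by (simp add: mult.assoc[symmetric] del: of_nat_Suc sum.lessThan_Suc)
    qed
    finally show ?thesis .
  qed
  have conv: "(\<lambda>N. \<integral>\<^sup>+p. ennreal (h N p) \<partial>(?G \<Otimes>\<^sub>M ?G)) \<longlonglongrightarrow> (\<integral>\<^sup>+p. ennreal (lin p) \<partial>(?G \<Otimes>\<^sub>M ?G))"
  proof (rule nn_integral_dominated_convergence[where w="\<lambda>p. ennreal (w p)"])
    show "(\<lambda>p. ennreal (lin p)) \<in> borel_measurable (?G \<Otimes>\<^sub>M ?G)"
      using borel_measurable_LIMSEQ_real[OF lim h_meas] by simp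
    show "(\<lambda>p. ennreal (w p)) \<in> borel_measurable (?G \<Otimes>\<^sub>M ?G)"
      unfolding w_def by measurable
    show "(\<integral>\<^sup>+p. ennreal (w p) \<partial>(?G \<Otimes>\<^sub>M ?G)) < \<infinity>"
      unfolding w_def by (rule nn_integral_gaussian_pair_exp_abs)
    show "\<And>N. AE p in ?G \<Otimes>\<^sub>M ?G. ennreal (h N p) \<le> ennreal (w p)"
      by (intro AE_I2 ennreal_leI bound)
    show "AE p in ?G \<Otimes>\<^sub>M ?G. (\<lambda>N. ennreal (h N p)) \<longlonglongrightarrow> ennreal (lin p)"
      using lim by auto
  qed simp
  have "(\<integral>\<^sup>+p. ennreal (lin p) \<partial>(?G \<Otimes>\<^sub>M ?G)) = (\<integral>\<^sup>+x. \<integral>\<^sup>+y. ennreal (lin (x, y)) \<partial>?G \<partial>?G)"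
    using borel_measurable_LIMSEQ_real[OF lim h_meas] by (subst G.nn_integral_fst[symmetric]) simp_all
  also have "\<dots> = (\<integral>\<^sup>+x. ennreal (exp ((\<Sum>j<d. (t * pi / 2 * G x j)\<^sup>2) / 2)) \<partial>?G)"
    by (subst nn_integral_gaussian_vector_exp_linear[symmetric])
      (simp add: lin_def sum_distrib_left mult_ac)
  also have "\<dots> \<le> (\<integral>\<^sup>+x. ennreal (exp (t\<^sup>2 * pi\<^sup>2 * L\<^sup>2 / 8)) \<partial>?G)"
  proof (intro nn_integral_mono ennreal_leI)
    fix x
    have "(\<Sum>j<d. (t * pi / 2 * G x j)\<^sup>2) / 2 = t\<^sup>2 * pi\<^sup>2 / 8 * (\<Sum>j<d. (G x j)\<^sup>2)"
      by (simp add: power_mult_distrib power_divide sum_distrib_left sum_divide_distrib)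
    also have "\<dots> \<le> t\<^sup>2 * pi\<^sup>2 / 8 * L\<^sup>2"
      by (intro mult_left_mono grad) simp
    finally show "exp ((\<Sum>j<d. (t * pi / 2 * G x j)\<^sup>2) / 2) \<le> exp (t\<^sup>2 * pi\<^sup>2 * L\<^sup>2 / 8)"
      by simp
  qed
  also have "\<dots> = ennreal (exp (t\<^sup>2 * pi\<^sup>2 * L\<^sup>2 / 8))"
    by (simp add: G.emeasure_space_1)
  finally have "(\<integral>\<^sup>+p. ennreal (lin p) \<partial>(?G \<Otimes>\<^sub>M ?G)) \<le> ennreal (exp (t\<^sup>2 * pi\<^sup>2 * L\<^sup>2 / 8))" .
  moreover have "(\<integral>\<^sup>+p. ennreal (exp (t * (F (snd p) - F (fst p)))) \<partial>(?G \<Otimes>\<^sub>M ?G))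
      \<le> (\<integral>\<^sup>+p. ennreal (lin p) \<partial>(?G \<Otimes>\<^sub>M ?G))"
    by (rule LIMSEQ_le_const[OF conv]) (use step in blast)
  ultimately show ?thesis by (rule order.trans[rotated])
qed

section \<open>Concentration of sums of ridge functions\<close>

text \<open>The average of \<open>\<sigma>\<close> over \<open>[x, x + e]\<close>: its derivative is a difference quotient of \<open>\<sigma>\<close>, and it equals a value
  of \<open>\<sigma>\<close> at a point of that interval.\<close>

lemma lipschitz_smooth_approximation:
  fixes \<sigma> :: "real \<Rightarrow> real"
  assumes lip: "l-lipschitz_on UNIV \<sigma>" and e: "0 < e"
  obtains \<tau> \<tau>' where "\<And>x. (\<tau> has_real_derivative \<tau>' x) (at x)" "\<And>x. \<bar>\<tau>' x\<bar> \<le> l"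
    "\<And>x. \<bar>\<tau> x - \<sigma> x\<bar> \<le> l * e"
proof -
  have l: "\<bar>\<sigma> x - \<sigma> y\<bar> \<le> l * \<bar>x - y\<bar>" for x y
    using lipschitz_onD[OF lip, of x y] by (simp add: dist_real_def)
  have "isCont \<sigma> x" for x
    using lipschitz_on_continuous_on[OF lip] by (simp add: continuous_on_eq_continuous_at)
  then obtain S where S: "\<And>x. (S has_real_derivative \<sigma> x) (at x)"
    using einterval_antiderivative[of "-\<infinity>" \<infinity> \<sigma>]
    by (auto simp: has_real_derivative_iff_has_vector_derivative)
  show ?thesis
  proof
    fix x
    have S': "((\<lambda>x. S (x + e)) has_real_derivative \<sigma> (x + e)) (at x)"
      using S[of "x + e"] by (simp add: DERIV_shift)
    show "((\<lambda>x. (S (x + e) - S x) / e) has_real_derivative (\<sigma> (x + e) - \<sigma> x) / e) (at x)"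
      using e by (intro DERIV_cdivide DERIV_diff S S')
    show "\<bar>(\<sigma> (x + e) - \<sigma> x) / e\<bar> \<le> l"
      using l[of "x + e" x] e by (simp add: abs_divide field_simps)
    obtain z where z: "x < z" "z < x + e" "S (x + e) - S x = (x + e - x) * \<sigma> z"
      using MVT2[of x "x + e" S \<sigma>] S e by auto
    then have "(S (x + e) - S x) / e = \<sigma> z" using e by simp
    moreover have "l * \<bar>z - x\<bar> \<le> l * e"
      using z lipschitz_on_nonneg[OF lip] by (intro mult_left_mono) auto
    ultimately show "\<bar>(S (x + e) - S x) / e - \<sigma> x\<bar> \<le> l * e"
      using l[of z x] by simp
  qed
qed

lemma lipschitz_borel_measurable:
  fixes \<sigma> :: "real \<Rightarrow> real"
  assumes "l-lipschitz_on UNIV \<sigma>"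
  shows "\<sigma> \<in> borel_measurable borel"
  using lipschitz_on_continuous_on[OF assms] by (rule borel_measurable_continuous_onI)

text \<open>The hypothesis \<open>op\<close> is what bounds the gradient \<open>\<Sum>\<^sub>i a\<^sub>i \<tau>'(x\<^sub>i\<^sup>T w) x\<^sub>i\<close> in norm by \<open>L\<close>, for every smooth
  approximation \<open>\<tau>\<close> of \<open>\<sigma>\<close> with derivative bounded by \<open>l\<close>. The uniform error of the approximation costs the factor
  \<open>c e\<close>, which tends to one.\<close>

lemma ridge_sum_exp_difference:
  fixes \<sigma> :: "real \<Rightarrow> real" and X :: "nat \<Rightarrow> nat \<Rightarrow> real"
  assumes lip: "l-lipschitz_on UNIV \<sigma>"
    and op: "\<And>b. (\<And>i. i < n \<Longrightarrow> \<bar>b i\<bar> \<le> l * \<bar>a i\<bar>) \<Longrightarrow> (\<Sum>j<d. (\<Sum>i<n. X j i * b i)\<^sup>2) \<le> L\<^sup>2"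
  defines "F \<equiv> \<lambda>w. \<Sum>i<n. a i * \<sigma> (\<Sum>j<d. X j i * w j)"
  shows "(\<integral>\<^sup>+p. ennreal (exp (t * (F (snd p) - F (fst p)))) \<partial>(gaussian_vector d \<Otimes>\<^sub>M gaussian_vector d))
    \<le> ennreal (exp (t\<^sup>2 * pi\<^sup>2 * L\<^sup>2 / 8))"
proof -
  let ?G = "gaussian_vector d"
  interpret G: prob_space ?G by (rule prob_space_gaussian_vector)
  have l0: "0 \<le> l" by (rule lipschitz_on_nonneg[OF lip])
  note [measurable] = lipschitz_borel_measurable[OF lip]
  define A where "A = (\<Sum>i<n. \<bar>a i\<bar>)"
  define c where "c e = exp (2 * \<bar>t\<bar> * A * l * e)" for e
  have smooth: "(\<integral>\<^sup>+p. ennreal (exp (t * (F (snd p) - F (fst p)))) \<partial>(?G \<Otimes>\<^sub>M ?G))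
      \<le> ennreal (c e * exp (t\<^sup>2 * pi\<^sup>2 * L\<^sup>2 / 8))" if e: "0 < e" for e
  proof -
    from lipschitz_smooth_approximation[OF lip e] obtain \<tau> \<tau>' where
      der: "\<And>x. (\<tau> has_real_derivative \<tau>' x) (at x)" and bd: "\<And>x. \<bar>\<tau>' x\<bar> \<le> l"
      and apx: "\<And>x. \<bar>\<tau> x - \<sigma> x\<bar> \<le> l * e" by blast
    have [measurable]: "\<tau> \<in> borel_measurable borel"
      using der by (intro borel_measurable_continuous_onI continuous_at_imp_continuous_on)
        (auto intro: DERIV_isCont)
    have lip\<tau>: "\<bar>\<tau> x - \<tau> y\<bar> \<le> l * \<bar>x - y\<bar>" for x y
      using field_differentiable_bound[of UNIV \<tau> \<tau>' l x y] der bd by auto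
    define H where "H w = (\<Sum>i<n. a i * \<tau> (\<Sum>j<d. X j i * w j))" for w
    define g where "g x j = (\<Sum>i<n. X j i * (a i * \<tau>' (\<Sum>k<d. X k i * x k)))" for x j
    define K where "K = (\<Sum>i<n. \<Sum>j<d. \<bar>a i\<bar> * (l * \<bar>X j i\<bar>))"
    have "(\<integral>\<^sup>+p. ennreal (exp (t * (H (snd p) - H (fst p)))) \<partial>(?G \<Otimes>\<^sub>M ?G))
      \<le> ennreal (exp (t\<^sup>2 * pi\<^sup>2 * L\<^sup>2 / 8))"
    proof (rule maurey_pisier_smooth[where K=K and G=g])
      show "H \<in> borel_measurable ?G"
        unfolding H_def by measurable
      show "\<bar>H x - H y\<bar> \<le> K * (\<Sum>j<d. \<bar>x j - y j\<bar>)" for x y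
      proof -
        let ?D = "\<Sum>j<d. \<bar>x j - y j\<bar>"
        have "\<bar>H x - H y\<bar> \<le> (\<Sum>i<n. \<bar>a i * (\<tau> (\<Sum>j<d. X j i * x j) - \<tau> (\<Sum>j<d. X j i * y j))\<bar>)"
          unfolding H_def sum_subtractf[symmetric] right_diff_distrib[symmetric] by (rule sum_abs)
        also have "\<dots> \<le> (\<Sum>i<n. \<Sum>j<d. \<bar>a i\<bar> * (l * \<bar>X j i\<bar>) * ?D)"
        proof (rule sum_mono)
          fix i
          have "\<bar>\<tau> (\<Sum>j<d. X j i * x j) - \<tau> (\<Sum>j<d. X j i * y j)\<bar>
              \<le> l * \<bar>\<Sum>j<d. X j i * (x j - y j)\<bar>"
            using lip\<tau> by (simp add: sum_subtractf right_diff_distrib)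
          also have "\<dots> \<le> l * (\<Sum>j<d. \<bar>X j i\<bar> * ?D)"
          proof (intro mult_left_mono l0 order.trans[OF sum_abs] sum_mono)
            fix j assume j: "j \<in> {..<d}"
            have "\<bar>x j - y j\<bar> \<le> ?D"
              using j by (intro member_le_sum) auto
            then show "\<bar>X j i * (x j - y j)\<bar> \<le> \<bar>X j i\<bar> * ?D"
              by (simp add: abs_mult mult_left_mono)
          qed
          finally have "\<bar>a i\<bar> * \<bar>\<tau> (\<Sum>j<d. X j i * x j) - \<tau> (\<Sum>j<d. X j i * y j)\<bar>
              \<le> \<bar>a i\<bar> * (l * (\<Sum>j<d. \<bar>X j i\<bar> * ?D))"
            by (rule mult_left_mono) simp
          then show "\<bar>a i * (\<tau> (\<Sum>j<d. X j i * x j) - \<tau> (\<Sum>j<d. X j i * y j))\<bar>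
              \<le> (\<Sum>j<d. \<bar>a i\<bar> * (l * \<bar>X j i\<bar>) * ?D)"
            by (simp add: abs_mult sum_distrib_left mult.assoc)
        qed
        also have "\<dots> = K * ?D"
          by (simp add: K_def sum_distrib_right)
        finally show ?thesis .
      qed
      show "((\<lambda>h. H (\<lambda>j. cos h * x j + sin h * y j)) has_real_derivative (\<Sum>j<d. g x j * y j)) (at 0)" for x y
      proof -
        have inner: "((\<lambda>h. \<Sum>j<d. X j i * (cos h * x j + sin h * y j)) has_real_derivative (\<Sum>j<d. X j i * y j)) (at 0)" for i
          by (rule derivative_eq_intros refl | simp add: mult.commute)+
        have "((\<lambda>h. a i * \<tau> (\<Sum>j<d. X j i * (cos h * x j + sin h * y j))) has_real_derivative
            a i * (\<tau>' (\<Sum>j<d. X j i * x j) * (\<Sum>j<d. X j i * y j))) (at 0)" for i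
          using DERIV_chain2[OF der inner[of i]] by (intro DERIV_cmult) simp
        then have "((\<lambda>h. H (\<lambda>j. cos h * x j + sin h * y j)) has_real_derivative
            (\<Sum>i<n. a i * (\<tau>' (\<Sum>j<d. X j i * x j) * (\<Sum>j<d. X j i * y j)))) (at 0)"
          unfolding H_def by (intro DERIV_sum)
        also have "(\<Sum>i<n. a i * (\<tau>' (\<Sum>j<d. X j i * x j) * (\<Sum>j<d. X j i * y j))) = (\<Sum>j<d. g x j * y j)"
          unfolding g_def sum_distrib_left sum_distrib_right
          by (subst sum.swap) (simp add: mult_ac)
        finally show ?thesis .
      qed
      show "(\<Sum>j<d. (g x j)\<^sup>2) \<le> L\<^sup>2" for x
        unfolding g_def
      proof (rule op)
        fix i
        have "\<bar>a i\<bar> * \<bar>\<tau>' (\<Sum>k<d. X k i * x k)\<bar> \<le> \<bar>a i\<bar> * l"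
          by (intro mult_left_mono bd) simp
        then show "\<bar>a i * \<tau>' (\<Sum>k<d. X k i * x k)\<bar> \<le> l * \<bar>a i\<bar>"
          by (simp add: abs_mult mult.commute[of l])
      qed
    qed
    have close: "\<bar>F w - H w\<bar> \<le> A * l * e" for w
    proof -
      have "\<bar>F w - H w\<bar> \<le> (\<Sum>i<n. \<bar>a i * (\<sigma> (\<Sum>j<d. X j i * w j) - \<tau> (\<Sum>j<d. X j i * w j))\<bar>)"
        unfolding F_def H_def sum_subtractf[symmetric] right_diff_distrib[symmetric] by (rule sum_abs)
      also have "\<dots> \<le> (\<Sum>i<n. \<bar>a i\<bar> * (l * e))"
        using apx by (intro sum_mono) (simp add: abs_mult abs_minus_commute mult_left_mono)
      finally show ?thesis by (simp add: A_def sum_distrib_right mult.assoc)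
    qed
    have "(\<integral>\<^sup>+p. ennreal (exp (t * (F (snd p) - F (fst p)))) \<partial>(?G \<Otimes>\<^sub>M ?G))
      \<le> (\<integral>\<^sup>+p. ennreal (c e) * ennreal (exp (t * (H (snd p) - H (fst p)))) \<partial>(?G \<Otimes>\<^sub>M ?G))"
    proof (rule nn_integral_mono)
      fix p :: "(nat \<Rightarrow> real) \<times> (nat \<Rightarrow> real)"
      have "\<bar>(F (snd p) - F (fst p)) - (H (snd p) - H (fst p))\<bar> \<le> 2 * (A * l * e)"
        using close[of "snd p"] close[of "fst p"] by linarith
      then have "\<bar>t\<bar> * \<bar>(F (snd p) - F (fst p)) - (H (snd p) - H (fst p))\<bar> \<le> \<bar>t\<bar> * (2 * (A * l * e))"
        by (rule mult_left_mono) simp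
      then have "\<bar>t * (F (snd p) - F (fst p)) - t * (H (snd p) - H (fst p))\<bar> \<le> \<bar>t\<bar> * (2 * (A * l * e))"
        by (simp only: abs_mult[symmetric] right_diff_distrib)
      then have "t * (F (snd p) - F (fst p)) \<le> 2 * \<bar>t\<bar> * A * l * e + t * (H (snd p) - H (fst p))"
        by (simp add: abs_le_iff mult_ac)
      then show "ennreal (exp (t * (F (snd p) - F (fst p)))) \<le> ennreal (c e) * ennreal (exp (t * (H (snd p) - H (fst p))))"
        by (simp add: c_def ennreal_mult[symmetric] exp_add[symmetric])
    qed
    also have "\<dots> = ennreal (c e) * (\<integral>\<^sup>+p. ennreal (exp (t * (H (snd p) - H (fst p)))) \<partial>(?G \<Otimes>\<^sub>M ?G))"
      unfolding H_def by (rule nn_integral_cmult) measurable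
    also have "\<dots> \<le> ennreal (c e) * ennreal (exp (t\<^sup>2 * pi\<^sup>2 * L\<^sup>2 / 8))"
      by (intro mult_left_mono) (fact, simp)
    finally show ?thesis
      by (simp add: ennreal_mult c_def)
  qed
  have "(\<lambda>k. 2 * \<bar>t\<bar> * A * l * (1 / real (Suc k))) \<longlonglongrightarrow> 2 * \<bar>t\<bar> * A * l * 0"
    by (intro tendsto_mult tendsto_const LIMSEQ_Suc[OF lim_1_over_n])
  then have "(\<lambda>k. c (1 / real (Suc k))) \<longlonglongrightarrow> exp (2 * \<bar>t\<bar> * A * l * 0)"
    unfolding c_def by (rule tendsto_exp)
  from tendsto_ennrealI[OF tendsto_mult[OF this tendsto_const]]
  have "(\<lambda>k. ennreal (c (1 / real (Suc k)) * exp (t\<^sup>2 * pi\<^sup>2 * L\<^sup>2 / 8))) \<longlonglongrightarrow> ennreal (exp (t\<^sup>2 * pi\<^sup>2 * L\<^sup>2 / 8))"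
    by simp
  then show ?thesis
    by (rule LIMSEQ_le_const) (use smooth[of "1 / real (Suc _)"] in auto)
qed

text \<open>Jensen's inequality in an independent copy replaces that copy by the mean.\<close>

lemma (in prob_space) nn_integral_exp_centered_le:
  fixes F :: "'a \<Rightarrow> real"
  assumes F: "integrable M F"
  shows "(\<integral>\<^sup>+x. ennreal (exp (t * (F x - expectation F))) \<partial>M)
    \<le> (\<integral>\<^sup>+p. ennreal (exp (t * (F (snd p) - F (fst p)))) \<partial>(M \<Otimes>\<^sub>M M))"
proof -
  have [measurable]: "F \<in> borel_measurable M" using F by simp
  interpret MM: pair_prob_space M M ..
  have jensen: "ennreal (exp (expectation f)) \<le> (\<integral>\<^sup>+x. ennreal (exp (f x)) \<partial>M)"
    if f: "integrable M f" for f :: "'a \<Rightarrow> real"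
  proof (cases "(\<integral>\<^sup>+x. ennreal (exp (f x)) \<partial>M) = \<infinity>")
    case False
    then have int: "integrable M (\<lambda>x. exp (f x))"
      using f by (intro integrableI_nonneg) (auto simp: less_top)
    have "exp (expectation f) \<le> expectation (\<lambda>x. exp (f x))"
      using f int exp_convex by (intro jensens_inequality[where I=UNIV]) auto
    then show ?thesis
      using int by (subst nn_integral_eq_integral) (auto intro: ennreal_leI)
  qed simp
  have "(\<integral>\<^sup>+x. ennreal (exp (t * (F x - expectation F))) \<partial>M)
      \<le> (\<integral>\<^sup>+x. \<integral>\<^sup>+y. ennreal (exp (t * (F x - F y))) \<partial>M \<partial>M)"
  proof (rule nn_integral_mono)
    fix x
    have "expectation (\<lambda>y. t * (F x - F y)) = t * (F x - expectation F)"
      using F by (simp add: prob_space)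
    moreover have "integrable M (\<lambda>y. t * (F x - F y))"
      using F by simp
    ultimately show "ennreal (exp (t * (F x - expectation F))) \<le> (\<integral>\<^sup>+y. ennreal (exp (t * (F x - F y))) \<partial>M)"
      using jensen by metis
  qed
  also have "\<dots> = (\<integral>\<^sup>+p. ennreal (exp (t * (F (snd p) - F (fst p)))) \<partial>(M \<Otimes>\<^sub>M M))"
    by (subst MM.nn_integral_snd[symmetric]) simp_all
  finally show ?thesis .
qed

section \<open>Squares of sub-Gaussian variables\<close>

text \<open>Linearize the square with an independent standard normal \<open>z\<close>: \<open>exp (g\<^sup>2 / (4 s\<^sup>2))\<close> is the mean of
  \<open>exp (g z / (sqrt 2 s))\<close>. Exchanging the integrals, the sub-Gaussian bound leaves the mean of \<open>exp (z\<^sup>2 / 4)\<close>.\<close>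

lemma (in prob_space) subgaussian_exp_square:
  fixes g :: "'a \<Rightarrow> real"
  assumes g [measurable]: "g \<in> borel_measurable M" and s: "0 < s"
    and mgf: "\<And>t. (\<integral>\<^sup>+x. ennreal (exp (t * g x)) \<partial>M) \<le> ennreal (exp (t\<^sup>2 * s\<^sup>2 / 2))"
  shows "(\<integral>\<^sup>+x. ennreal (exp ((g x)\<^sup>2 / (4 * s\<^sup>2))) \<partial>M) \<le> ennreal (sqrt 2)"
proof -
  let ?N = "std_normal_distribution"
  interpret P: pair_sigma_finite M ?N ..
  have "(\<integral>\<^sup>+x. ennreal (exp ((g x)\<^sup>2 / (4 * s\<^sup>2))) \<partial>M)
      = (\<integral>\<^sup>+x. \<integral>\<^sup>+z. ennreal (exp (g x / (sqrt 2 * s) * z)) \<partial>?N \<partial>M)"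
    by (simp only: nn_integral_std_normal_exp) (simp add: power_divide power_mult_distrib)
  also have "\<dots> = (\<integral>\<^sup>+z. \<integral>\<^sup>+x. ennreal (exp (g x / (sqrt 2 * s) * z)) \<partial>M \<partial>?N)"
    by (rule P.Fubini'[symmetric]) measurable
  also have "\<dots> \<le> (\<integral>\<^sup>+z. ennreal (exp (z\<^sup>2 / 4)) \<partial>?N)"
  proof (rule nn_integral_mono)
    fix z
    have "(\<integral>\<^sup>+x. ennreal (exp (z / (sqrt 2 * s) * g x)) \<partial>M) \<le> ennreal (exp ((z / (sqrt 2 * s))\<^sup>2 * s\<^sup>2 / 2))"
      by (rule mgf)
    also have "(z / (sqrt 2 * s))\<^sup>2 * s\<^sup>2 / 2 = z\<^sup>2 / 4"
      using s by (simp add: power_divide power_mult_distrib)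
    finally show "(\<integral>\<^sup>+x. ennreal (exp (g x / (sqrt 2 * s) * z)) \<partial>M) \<le> ennreal (exp (z\<^sup>2 / 4))"
      by (simp add: mult.commute)
  qed
  also have "\<dots> = ennreal (sqrt 2)"
    by (rule nn_integral_std_normal_exp_square)
  finally show ?thesis .
qed

text \<open>From the quadratic term on, each term of the series of \<open>exp (r y)\<close> is at most \<open>r\<^sup>2\<close> times the corresponding
  term of \<open>exp \<bar>y\<bar>\<close>.\<close>

lemma exp_mult_le_quadratic:
  fixes r y :: real
  assumes r: "\<bar>r\<bar> \<le> 1"
  shows "exp (r * y) \<le> 1 + r * y + r\<^sup>2 * exp \<bar>y\<bar>"
proof -
  define a where "a x n = inverse (fact (n + 2)) *\<^sub>R (x ^ (n + 2))" for x :: real and n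
  have two: "exp x = 1 + x + suminf (a x)" for x
    unfolding a_def by (rule exp_first_two_terms)
  have summ: "summable (a x)" for x
    using summable_exp_generic[of x] unfolding a_def by (subst summable_iff_shift)
  have "suminf (a (r * y)) \<le> (\<Sum>n. r\<^sup>2 * a \<bar>y\<bar> n)"
  proof (rule suminf_le)
    show "summable (\<lambda>n. r\<^sup>2 * a \<bar>y\<bar> n)" by (intro summable_mult summ)
    fix n
    have "(r * y) ^ (n + 2) \<le> \<bar>r\<bar> ^ (n + 2) * \<bar>y\<bar> ^ (n + 2)"
      by (rule order.trans[OF abs_ge_self]) (simp add: abs_mult power_abs power_mult_distrib)
    also have "\<dots> \<le> r\<^sup>2 * \<bar>y\<bar> ^ (n + 2)"
    proof (rule mult_right_mono)
      have "\<bar>r\<bar> ^ (n + 2) = \<bar>r\<bar> ^ n * r\<^sup>2" by (simp only: power_add power2_abs)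
      also have "\<dots> \<le> 1 * r\<^sup>2" using r by (intro mult_right_mono power_le_one) auto
      finally show "\<bar>r\<bar> ^ (n + 2) \<le> r\<^sup>2" by simp
    qed simp
    finally have "(r * y) ^ (n + 2) \<le> r\<^sup>2 * \<bar>y\<bar> ^ (n + 2)" .
    then have "inverse (fact (n + 2)) * (r * y) ^ (n + 2) \<le> inverse (fact (n + 2)) * (r\<^sup>2 * \<bar>y\<bar> ^ (n + 2))"
      by (rule mult_left_mono) simp
    then show "a (r * y) n \<le> r\<^sup>2 * a \<bar>y\<bar> n"
      by (simp add: a_def mult_ac)
  qed (rule summ)
  also have "\<dots> = r\<^sup>2 * (exp \<bar>y\<bar> - 1 - \<bar>y\<bar>)"
    using two[of "\<bar>y\<bar>"] by (simp add: suminf_mult[OF summ])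
  also have "\<dots> \<le> r\<^sup>2 * exp \<bar>y\<bar>"
    by (intro mult_left_mono) auto
  finally show ?thesis using two[of "r * y"] by simp
qed

text \<open>Apply the quadratic bound on the exponential with \<open>r = 4 s\<^sup>2 t\<close>. The linear term has mean zero, and
  \<open>exp (1/2) sqrt 2 \<le> 3\<close> bounds the mean of the remainder.\<close>

lemma (in prob_space) subgaussian_centered_square_mgf:
  fixes g :: "'a \<Rightarrow> real"
  assumes g [measurable]: "g \<in> borel_measurable M" and s: "0 < s"
    and mgf: "\<And>t. (\<integral>\<^sup>+x. ennreal (exp (t * g x)) \<partial>M) \<le> ennreal (exp (t\<^sup>2 * s\<^sup>2 / 2))"
    and t: "\<bar>t\<bar> \<le> 1 / (4 * s\<^sup>2)"
  shows "(\<integral>\<^sup>+x. ennreal (exp (t * ((g x)\<^sup>2 - expectation (\<lambda>x. (g x)\<^sup>2)))) \<partial>M)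
      \<le> ennreal (exp (3 * (4 * s\<^sup>2 * t)\<^sup>2))"
proof -
  define u where "u = 1 / (4 * s\<^sup>2)"
  have u: "u > 0" using s by (simp add: u_def)
  have nn: "(\<integral>\<^sup>+x. ennreal (exp (u * (g x)\<^sup>2)) \<partial>M) \<le> ennreal (sqrt 2)"
    using subgaussian_exp_square[OF g s mgf] by (simp add: u_def)
  have int_exp: "integrable M (\<lambda>x. exp (u * (g x)\<^sup>2))"
    using le_less_trans[OF nn] by (intro integrableI_nonneg) auto
  have exp_bound: "expectation (\<lambda>x. exp (u * (g x)\<^sup>2)) \<le> sqrt 2"
    using nn int_exp by (subst (asm) nn_integral_eq_integral) auto
  have sq_le: "u * (g x)\<^sup>2 \<le> exp (u * (g x)\<^sup>2) - 1" for x
    using exp_ge_add_one_self[of "u * (g x)\<^sup>2"] by linarith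
  have int_usq: "integrable M (\<lambda>x. u * (g x)\<^sup>2)"
  proof (rule Bochner_Integration.integrable_bound[OF int_exp])
    show "AE x in M. norm (u * (g x)\<^sup>2) \<le> norm (exp (u * (g x)\<^sup>2))"
      using u sq_le by (intro AE_I2) (simp add: abs_mult, smt (verit))
  qed simp
  then have int_sq: "integrable M (\<lambda>x. (g x)\<^sup>2)"
    using u integrable_mult_left_iff[of M u "\<lambda>x. (g x)\<^sup>2"] by simp
  define v where "v = expectation (\<lambda>x. (g x)\<^sup>2)"
  have v0: "0 \<le> v" unfolding v_def by simp
  have uv: "u * v \<le> 1 / 2"
  proof -
    have "u * v = expectation (\<lambda>x. u * (g x)\<^sup>2)" by (simp add: v_def)
    also have "\<dots> \<le> expectation (\<lambda>x. exp (u * (g x)\<^sup>2) - 1)"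
      using int_usq int_exp sq_le by (intro integral_mono) auto
    also have "\<dots> \<le> sqrt 2 - 1"
      using exp_bound int_exp by (simp add: prob_space)
    also have "\<dots> \<le> 1 / 2"
    proof -
      have "sqrt 2 \<le> (3 / 2 :: real)"
        by (rule real_le_lsqrt) (simp_all add: power2_eq_square)
      then show ?thesis by simp
    qed
    finally show ?thesis .
  qed
  define r where "r = t / u"
  have r: "\<bar>r\<bar> \<le> 1" using t u by (simp add: r_def u_def[symmetric] abs_divide)
  have pt: "exp (t * ((g x)\<^sup>2 - v)) \<le> 1 + t * ((g x)\<^sup>2 - v) + r\<^sup>2 * (exp (1/2) * exp (u * (g x)\<^sup>2))" for x
  proof -
    have "\<bar>u * ((g x)\<^sup>2 - v)\<bar> \<le> 1 / 2 + u * (g x)\<^sup>2"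
    proof -
      have "\<bar>u * ((g x)\<^sup>2 - v)\<bar> \<le> u * (g x)\<^sup>2 + u * v"
        using u v0 by (simp add: abs_le_iff right_diff_distrib)
      then show ?thesis using uv by simp
    qed
    then have "exp \<bar>u * ((g x)\<^sup>2 - v)\<bar> \<le> exp (1/2) * exp (u * (g x)\<^sup>2)"
      by (simp flip: exp_add)
    then have "r\<^sup>2 * exp \<bar>u * ((g x)\<^sup>2 - v)\<bar> \<le> r\<^sup>2 * (exp (1/2) * exp (u * (g x)\<^sup>2))"
      by (rule mult_left_mono) simp
    moreover have eq: "r * (u * ((g x)\<^sup>2 - v)) = t * ((g x)\<^sup>2 - v)"
      using u by (simp add: r_def)
    have "exp (t * ((g x)\<^sup>2 - v)) \<le> 1 + t * ((g x)\<^sup>2 - v) + r\<^sup>2 * exp \<bar>u * ((g x)\<^sup>2 - v)\<bar>"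
      using exp_mult_le_quadratic[OF r, of "u * ((g x)\<^sup>2 - v)"] unfolding eq .
    ultimately show ?thesis
      by (rule order.trans[rotated, OF add_left_mono])
  qed
  let ?q = "\<lambda>x. 1 + t * ((g x)\<^sup>2 - v) + r\<^sup>2 * (exp (1/2) * exp (u * (g x)\<^sup>2))"
  have int_q: "integrable M ?q"
    using int_sq int_exp by simp
  have "(\<integral>\<^sup>+x. ennreal (exp (t * ((g x)\<^sup>2 - v))) \<partial>M) \<le> (\<integral>\<^sup>+x. ennreal (?q x) \<partial>M)"
    by (intro nn_integral_mono ennreal_leI pt)
  also have "\<dots> = ennreal (expectation ?q)"
    using int_q by (intro nn_integral_eq_integral AE_I2 order.trans[OF exp_ge_zero pt])
  also have "\<dots> \<le> ennreal (exp (3 * r\<^sup>2))"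
  proof (rule ennreal_leI)
    have "expectation ?q = 1 + r\<^sup>2 * (exp (1/2) * expectation (\<lambda>x. exp (u * (g x)\<^sup>2)))"
      using int_sq int_exp by (simp add: prob_space v_def)
    also have "\<dots> \<le> 1 + r\<^sup>2 * (exp (1/2) * sqrt 2)"
      using exp_bound by (intro add_left_mono mult_left_mono) auto
    also have "\<dots> \<le> 1 + r\<^sup>2 * 3"
    proof (intro add_left_mono mult_left_mono)
      have "(exp (1/2) * sqrt 2)\<^sup>2 = exp (1 :: real) * 2"
        by (simp add: power_mult_distrib flip: exp_double)
      also have "\<dots> \<le> 3\<^sup>2" using exp_le by simp
      finally show "exp (1/2) * sqrt 2 \<le> (3 :: real)"
        by (rule power2_le_imp_le) simp
    qed simp
    also have "\<dots> \<le> exp (3 * r\<^sup>2)"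
      using exp_ge_add_one_self[of "3 * r\<^sup>2"] by (simp only: mult.commute)
    finally show "expectation ?q \<le> exp (3 * r\<^sup>2)" .
  qed
  also have "r = 4 * s\<^sup>2 * t"
    by (simp add: r_def u_def)
  finally show ?thesis by (simp add: v_def)
qed

section \<open>Independent rows of a Gaussian matrix\<close>

interpretation gaussian_rows: product_sigma_finite "\<lambda>_. gaussian_vector d0" for d0
  by (intro product_sigma_finite.intro prob_space_imp_sigma_finite prob_space_gaussian_vector)

lemma measurable_uncurry_gaussian:
  "(\<lambda>v. \<lambda>p\<in>{..<d1} \<times> {..<d0}. v (fst p) (snd p))
    \<in> measurable (Pi\<^sub>M {..<d1} (\<lambda>_. gaussian_vector d0)) (gaussian_matrix d1 d0)"
  unfolding gaussian_matrix_def
proof (rule measurable_restrict)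
  fix p :: "nat \<times> nat" assume p: "p \<in> {..<d1} \<times> {..<d0}"
  have row: "(\<lambda>v. v (fst p)) \<in> measurable (Pi\<^sub>M {..<d1} (\<lambda>_. gaussian_vector d0)) (gaussian_vector d0)"
    using p by (intro measurable_component_singleton) auto
  have entry: "(\<lambda>w. w (snd p)) \<in> measurable (gaussian_vector d0) std_normal_distribution"
    unfolding gaussian_vector_def using p by (intro measurable_component_singleton) auto
  show "(\<lambda>v. v (fst p) (snd p)) \<in> measurable (Pi\<^sub>M {..<d1} (\<lambda>_. gaussian_vector d0)) std_normal_distribution"
    by (rule measurable_compose[OF row entry])
qed

text \<open>A Gaussian matrix is a vector of independent Gaussian rows; both measures agree on boxes.\<close>

lemma distr_uncurry_gaussian:
  "distr (Pi\<^sub>M {..<d1} (\<lambda>_. gaussian_vector d0)) (gaussian_matrix d1 d0)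
      (\<lambda>v. \<lambda>p\<in>{..<d1} \<times> {..<d0}. v (fst p) (snd p)) = gaussian_matrix d1 d0"
    (is "distr ?P _ ?u = _")
  unfolding gaussian_matrix_def
proof (rule std_normal_prod.PiM_eqI)
  let ?I = "{..<d1} \<times> {..<d0}"
  let ?N = "std_normal_distribution"
  fix A :: "nat \<times> nat \<Rightarrow> real set"
  assume A: "\<And>p. p \<in> ?I \<Longrightarrow> A p \<in> sets ?N"
  have u: "?u \<in> measurable ?P (Pi\<^sub>M ?I (\<lambda>_. ?N))"
    using measurable_uncurry_gaussian unfolding gaussian_matrix_def .
  have box: "Pi\<^sub>E ?I A \<in> sets (Pi\<^sub>M ?I (\<lambda>_. ?N))"
    using A by (intro sets_PiM_I_finite) auto
  have row: "(\<Pi>\<^sub>E j\<in>{..<d0}. A (k, j)) \<in> sets (gaussian_vector d0)" if "k < d1" for k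
    unfolding gaussian_vector_def using A that by (intro sets_PiM_I_finite) auto
  have "?u -` Pi\<^sub>E ?I A \<inter> space ?P = (\<Pi>\<^sub>E k\<in>{..<d1}. \<Pi>\<^sub>E j\<in>{..<d0}. A (k, j))"
    using row[THEN sets.sets_into_space]
    by (auto simp: space_PiM PiE_iff gaussian_vector_def)
  then have "emeasure (distr ?P (Pi\<^sub>M ?I (\<lambda>_. ?N)) ?u) (Pi\<^sub>E ?I A)
      = emeasure ?P (\<Pi>\<^sub>E k\<in>{..<d1}. \<Pi>\<^sub>E j\<in>{..<d0}. A (k, j))"
    using u box by (simp add: emeasure_distr)
  also have "\<dots> = (\<Prod>k<d1. emeasure (gaussian_vector d0) (\<Pi>\<^sub>E j\<in>{..<d0}. A (k, j)))"
    using row by (intro gaussian_rows.emeasure_PiM) auto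
  also have "\<dots> = (\<Prod>k<d1. \<Prod>j<d0. emeasure ?N (A (k, j)))"
    unfolding gaussian_vector_def using A
    by (intro prod.cong refl std_normal_prod.emeasure_PiM) auto
  also have "\<dots> = (\<Prod>p\<in>?I. emeasure ?N (A p))"
    by (simp add: prod.cartesian_product)
  finally show "emeasure (distr ?P (Pi\<^sub>M ?I (\<lambda>_. ?N)) ?u) (Pi\<^sub>E ?I A) = (\<Prod>p\<in>?I. emeasure ?N (A p))" .
qed simp_all

lemma measurable_gaussian_matrix_row:
  assumes "k < d1"
  shows "(\<lambda>\<omega>. \<lambda>j\<in>{..<d0}. \<omega> (k, j)) \<in> measurable (gaussian_matrix d1 d0) (gaussian_vector d0)"
  unfolding gaussian_matrix_def gaussian_vector_def
  using assms by (intro measurable_restrict measurable_component_singleton) auto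

lemma nn_integral_gaussian_matrix_rows:
  assumes f: "f \<in> borel_measurable (gaussian_vector d0)"
  shows "(\<integral>\<^sup>+\<omega>. (\<Prod>k<d1. f (\<lambda>j\<in>{..<d0}. \<omega> (k, j))) \<partial>gaussian_matrix d1 d0)
    = (\<integral>\<^sup>+w. f w \<partial>gaussian_vector d0) ^ d1"
proof -
  let ?P = "Pi\<^sub>M {..<d1} (\<lambda>_. gaussian_vector d0)"
  let ?u = "\<lambda>v. \<lambda>p\<in>{..<d1} \<times> {..<d0}. v (fst p) (snd p)"
  have u: "?u \<in> measurable ?P (gaussian_matrix d1 d0)"
    by (rule measurable_uncurry_gaussian)
  have F: "(\<lambda>\<omega>. \<Prod>k<d1. f (\<lambda>j\<in>{..<d0}. \<omega> (k, j))) \<in> borel_measurable (gaussian_matrix d1 d0)"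
    by (intro borel_measurable_prod_ennreal measurable_compose[OF measurable_gaussian_matrix_row f]) simp
  have rows: "(\<lambda>j\<in>{..<d0}. ?u v (k, j)) = v k" if "v \<in> space ?P" "k < d1" for v k
    using that by (auto simp: space_PiM PiE_iff gaussian_vector_def extensional_def fun_eq_iff)
  have "(\<integral>\<^sup>+\<omega>. (\<Prod>k<d1. f (\<lambda>j\<in>{..<d0}. \<omega> (k, j))) \<partial>gaussian_matrix d1 d0)
      = (\<integral>\<^sup>+v. (\<Prod>k<d1. f (\<lambda>j\<in>{..<d0}. ?u v (k, j))) \<partial>?P)"
    using nn_integral_distr'[OF u F] by (simp only: distr_uncurry_gaussian)
  also have "\<dots> = (\<integral>\<^sup>+v. (\<Prod>k<d1. f (v k)) \<partial>?P)"
    by (intro nn_integral_cong prod.cong refl) (simp only: rows lessThan_iff)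
  also have "\<dots> = (\<Prod>k<d1. \<integral>\<^sup>+w. f w \<partial>gaussian_vector d0)"
    by (intro gaussian_rows.product_nn_integral_prod f) simp
  finally show ?thesis by simp
qed

text \<open>Markov's inequality for the exponential; independence of the rows turns the moment generating function of the sum
  into a power.\<close>

lemma gaussian_matrix_row_sum_chernoff:
  fixes h :: "(nat \<Rightarrow> real) \<Rightarrow> real"
  assumes h [measurable]: "h \<in> borel_measurable (gaussian_vector d0)" and t: "0 < t"
    and mgf: "(\<integral>\<^sup>+w. ennreal (exp (t * h w)) \<partial>gaussian_vector d0) \<le> ennreal (exp b)"
  shows "emeasure (gaussian_matrix d1 d0)
      {\<omega> \<in> space (gaussian_matrix d1 d0). r \<le> (\<Sum>k<d1. h (\<lambda>j\<in>{..<d0}. \<omega> (k, j)))}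
    \<le> ennreal (exp (real d1 * b - t * r))"
proof -
  let ?M = "gaussian_matrix d1 d0"
  let ?row = "\<lambda>\<omega> k. \<lambda>j\<in>{..<d0}. \<omega> (k, j)"
  have meas: "(\<lambda>\<omega>. \<Sum>k<d1. h (?row \<omega> k)) \<in> borel_measurable ?M"
    by (intro borel_measurable_sum measurable_compose[OF measurable_gaussian_matrix_row h]) simp
  have "emeasure ?M {\<omega> \<in> space ?M. r \<le> (\<Sum>k<d1. h (?row \<omega> k))}
      \<le> ennreal (exp (- t * r)) * (\<integral>\<^sup>+\<omega>. ennreal (exp (t * (\<Sum>k<d1. h (?row \<omega> k)))) * indicator (space ?M) \<omega> \<partial>?M)"
    using meas by (intro Chernoff_ineq_nn_integral_ge t) simp_all
  also have "(\<integral>\<^sup>+\<omega>. ennreal (exp (t * (\<Sum>k<d1. h (?row \<omega> k)))) * indicator (space ?M) \<omega> \<partial>?M)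
      = (\<integral>\<^sup>+\<omega>. (\<Prod>k<d1. ennreal (exp (t * h (?row \<omega> k)))) \<partial>?M)"
    by (intro nn_integral_cong) (simp add: sum_distrib_left exp_sum prod_ennreal)
  also have "\<dots> = (\<integral>\<^sup>+w. ennreal (exp (t * h w)) \<partial>gaussian_vector d0) ^ d1"
    by (rule nn_integral_gaussian_matrix_rows) measurable
  also have "ennreal (exp (- t * r)) * (\<integral>\<^sup>+w. ennreal (exp (t * h w)) \<partial>gaussian_vector d0) ^ d1
      \<le> ennreal (exp (- t * r)) * ennreal (exp b) ^ d1"
    by (intro mult_left_mono power_mono mgf) simp_all
  also have "\<dots> = ennreal (exp (real d1 * b - t * r))"
    by (simp add: ennreal_power ennreal_mult[symmetric] exp_of_nat_mult[symmetric] exp_add[symmetric])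
  finally show ?thesis .
qed

lemma gaussian_matrix_row_sum_two_sided:
  fixes h :: "(nat \<Rightarrow> real) \<Rightarrow> real"
  assumes h [measurable]: "h \<in> borel_measurable (gaussian_vector d0)" and t: "0 < t"
    and mgf: "\<And>t'. \<bar>t'\<bar> = t \<Longrightarrow> (\<integral>\<^sup>+w. ennreal (exp (t' * h w)) \<partial>gaussian_vector d0) \<le> ennreal (exp b)"
  shows "emeasure (gaussian_matrix d1 d0)
      {\<omega> \<in> space (gaussian_matrix d1 d0). r \<le> \<bar>\<Sum>k<d1. h (\<lambda>j\<in>{..<d0}. \<omega> (k, j))\<bar>}
    \<le> ennreal (2 * exp (real d1 * b - t * r))" (is "emeasure ?M ?S \<le> _")
proof -
  let ?S1 = "{\<omega> \<in> space ?M. r \<le> (\<Sum>k<d1. h (\<lambda>j\<in>{..<d0}. \<omega> (k, j)))}"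
  let ?S2 = "{\<omega> \<in> space ?M. r \<le> (\<Sum>k<d1. - h (\<lambda>j\<in>{..<d0}. \<omega> (k, j)))}"
  have [measurable]: "(\<lambda>\<omega>. h (\<lambda>j\<in>{..<d0}. \<omega> (k, j))) \<in> borel_measurable ?M" if "k \<in> {..<d1}" for k
    using measurable_compose[OF measurable_gaussian_matrix_row h] that by simp
  have "?S \<subseteq> ?S1 \<union> ?S2"
    by (auto simp: sum_negf)
  moreover have "?S1 \<union> ?S2 \<in> sets ?M"
    by measurable
  ultimately have "emeasure ?M ?S \<le> emeasure ?M (?S1 \<union> ?S2)"
    by (rule emeasure_mono)
  also have "\<dots> \<le> emeasure ?M ?S1 + emeasure ?M ?S2"
    by (rule emeasure_subadditive) measurable
  also have "\<dots> \<le> ennreal (exp (real d1 * b - t * r)) + ennreal (exp (real d1 * b - t * r))"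
    using mgf[of t] mgf[of "- t"] t
    by (intro add_mono gaussian_matrix_row_sum_chernoff) simp_all
  also have "\<dots> = ennreal (2 * exp (real d1 * b - t * r))"
    by (simp flip: ennreal_plus)
  finally show ?thesis .
qed

section \<open>Law of a linear functional and the mean of an activation\<close>


text \<open>Both characteristic functions are \<open>exp (- t\<^sup>2 \<parallel>x\<parallel>\<^sup>2 / 2)\<close>.\<close>

lemma distr_linear_gaussian_vector:
  "distr (gaussian_vector d) borel (\<lambda>w. \<Sum>j<d. x j * w j)
    = distr std_normal_distribution borel (\<lambda>z. L2_set x {..<d} * z)"
proof (rule Levy_uniqueness)
  interpret G: prob_space "gaussian_vector d" by (rule prob_space_gaussian_vector)
  let ?N = "std_normal_distribution"
  show "real_distribution (distr (gaussian_vector d) borel (\<lambda>w. \<Sum>j<d. x j * w j))"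
    by (rule G.real_distribution_distr) measurable
  show "real_distribution (distr ?N borel (\<lambda>z. L2_set x {..<d} * z))"
    by (rule std_normal.real_distribution_distr) simp
  show "char (distr (gaussian_vector d) borel (\<lambda>w. \<Sum>j<d. x j * w j))
      = char (distr ?N borel (\<lambda>z. L2_set x {..<d} * z))"
  proof
    fix t
    have N: "(\<integral>z. iexp (u * z) \<partial>?N) = complex_of_real (exp (- u\<^sup>2 / 2))" for u
      using fun_cong[OF char_std_normal_distribution, of u] by (simp add: char_def)
    have "char (distr (gaussian_vector d) borel (\<lambda>w. \<Sum>j<d. x j * w j)) t
        = (\<integral>w. (\<Prod>j<d. iexp ((t * x j) * w j)) \<partial>gaussian_vector d)"
      by (simp add: char_def integral_distr sum_distrib_left exp_sum mult.assoc)
    also have "\<dots> = (\<Prod>j<d. \<integral>z. iexp ((t * x j) * z) \<partial>?N)"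
      unfolding gaussian_vector_def
      by (intro std_normal_prod.product_integral_prod std_normal.integrable_iexp) simp_all
    also have "\<dots> = complex_of_real (exp (- (t * L2_set x {..<d})\<^sup>2 / 2))"
    proof -
      have "(\<Sum>j<d. - (t * x j)\<^sup>2 / 2) = - (t * L2_set x {..<d})\<^sup>2 / 2"
        by (simp add: L2_set_def sum_nonneg power_mult_distrib sum_distrib_left sum_negf sum_divide_distrib)
      then show ?thesis
        by (simp only: N of_real_prod[symmetric] exp_sum[symmetric] finite_lessThan)
    qed
    also have "\<dots> = char (distr ?N borel (\<lambda>z. L2_set x {..<d} * z)) t"
      by (simp only: N[symmetric]) (simp add: char_def integral_distr mult.assoc)
    finally show "char (distr (gaussian_vector d) borel (\<lambda>w. \<Sum>j<d. x j * w j)) t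
      = char (distr ?N borel (\<lambda>z. L2_set x {..<d} * z)) t" .
  qed
qed

lemma expectation_abs_std_normal_le_1: "(\<integral>z. \<bar>z\<bar> \<partial>std_normal_distribution) \<le> 1"
proof -
  have "(\<integral>z. \<bar>z\<bar> \<partial>std_normal_distribution) = sqrt (2 / pi)"
    using std_normal_distribution_odd_moments_abs[of 0] by simp
  also have "\<dots> \<le> 1"
    using pi_gt3 by (simp add: field_simps)
  finally show ?thesis .
qed

text \<open>Compare with the centred case \<open>r = 1\<close>: the difference of the arguments is \<open>(r - 1) z\<close>, and
  \<open>\<bar>r - 1\<bar> \<le> \<bar>r\<^sup>2 - 1\<bar>\<close> for \<open>r \<ge> 0\<close>.\<close>

lemma abs_expectation_lipschitz_scaled_le:
  fixes \<sigma> :: "real \<Rightarrow> real"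
  assumes lip: "l-lipschitz_on UNIV \<sigma>" and mean: "(\<integral>z. \<sigma> z \<partial>std_normal_distribution) = 0" and r: "0 \<le> r"
  shows "\<bar>\<integral>z. \<sigma> (r * z) \<partial>std_normal_distribution\<bar> \<le> l * \<bar>r\<^sup>2 - 1\<bar>"
proof -
  let ?N = "std_normal_distribution"
  have l0: "0 \<le> l" by (rule lipschitz_on_nonneg[OF lip])
  have l: "\<bar>\<sigma> x - \<sigma> y\<bar> \<le> l * \<bar>x - y\<bar>" for x y
    using lipschitz_onD[OF lip, of x y] by (simp add: dist_real_def)
  note [measurable] = lipschitz_borel_measurable[OF lip]
  have int_abs: "integrable ?N (\<lambda>z. \<bar>z\<bar>)"
    using integrable_std_normal_distribution_moment[of 1] by simp
  have int: "integrable ?N (\<lambda>z. \<sigma> (c * z))" for c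
  proof (rule Bochner_Integration.integrable_bound)
    show "integrable ?N (\<lambda>z. \<bar>\<sigma> 0\<bar> + l * \<bar>c\<bar> * \<bar>z\<bar>)"
      using int_abs by simp
    have "\<bar>\<sigma> (c * z)\<bar> \<le> \<bar>\<sigma> 0\<bar> + l * \<bar>c\<bar> * \<bar>z\<bar>" for z
      using l[of "c * z" 0] by (simp add: abs_mult mult.assoc)
    then show "AE z in ?N. norm (\<sigma> (c * z)) \<le> norm (\<bar>\<sigma> 0\<bar> + l * \<bar>c\<bar> * \<bar>z\<bar>)"
      by (intro AE_I2) (simp add: abs_of_nonneg l0)
  qed simp
  have "\<bar>\<integral>z. \<sigma> (r * z) \<partial>?N\<bar> = \<bar>\<integral>z. \<sigma> (r * z) - \<sigma> (1 * z) \<partial>?N\<bar>"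
    using mean int[of r] int[of 1] by simp
  also have "\<dots> \<le> (\<integral>z. \<bar>\<sigma> (r * z) - \<sigma> (1 * z)\<bar> \<partial>?N)"
    by (rule integral_abs_bound)
  also have "\<dots> \<le> (\<integral>z. l * \<bar>r - 1\<bar> * \<bar>z\<bar> \<partial>?N)"
  proof (rule integral_mono)
    show "integrable ?N (\<lambda>z. \<bar>\<sigma> (r * z) - \<sigma> (1 * z)\<bar>)"
      using int[of r] int[of 1] by simp
    show "integrable ?N (\<lambda>z. l * \<bar>r - 1\<bar> * \<bar>z\<bar>)" using int_abs by simp
    fix z
    have "\<bar>r * z - 1 * z\<bar> = \<bar>r - 1\<bar> * \<bar>z\<bar>" by (simp add: abs_mult[symmetric] left_diff_distrib)
    then show "\<bar>\<sigma> (r * z) - \<sigma> (1 * z)\<bar> \<le> l * \<bar>r - 1\<bar> * \<bar>z\<bar>"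
      using l[of "r * z" "1 * z"] by (simp add: mult.assoc)
  qed
  also have "\<dots> = l * \<bar>r - 1\<bar> * (\<integral>z. \<bar>z\<bar> \<partial>?N)" by simp
  also have "\<dots> \<le> l * \<bar>r - 1\<bar> * 1"
    using l0 by (intro mult_left_mono expectation_abs_std_normal_le_1) auto
  also have "\<dots> \<le> l * \<bar>r\<^sup>2 - 1\<bar>"
  proof -
    have "\<bar>r - 1\<bar> * 1 \<le> \<bar>r - 1\<bar> * (r + 1)" using r by (intro mult_left_mono) auto
    also have "\<dots> = \<bar>r\<^sup>2 - 1\<bar>"
      using r abs_mult[of "r - 1" "r + 1"] by (simp add: power2_eq_square algebra_simps)
    finally show ?thesis using l0 by (simp add: mult_left_mono)
  qed
  finally show ?thesis .
qed

text \<open>All integrability statements about features reduce to this growth condition.\<close>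

lemma integrable_gaussian_vector_exp_bound:
  fixes h :: "(nat \<Rightarrow> real) \<Rightarrow> real"
  assumes h: "h \<in> borel_measurable (gaussian_vector d)"
    and bound: "\<And>w. \<bar>h w\<bar> \<le> A * exp (c * (\<Sum>j<d. \<bar>w j\<bar>))"
  shows "integrable (gaussian_vector d) h"
proof (rule Bochner_Integration.integrable_bound[OF _ h])
  show "integrable (gaussian_vector d) (\<lambda>w. A * exp (c * (\<Sum>j<d. \<bar>w j\<bar>)))"
    using nn_integral_gaussian_vector_exp_abs[where c = c and d = d]
    by (intro integrable_mult_right integrableI_nonneg) (auto simp: less_top)
  show "AE w in gaussian_vector d. norm (h w) \<le> norm (A * exp (c * (\<Sum>j<d. \<bar>w j\<bar>)))"
    using bound by (intro AE_I2) (simp, meson abs_ge_self order.trans)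
qed

section \<open>Random features\<close>

locale random_features =
  fixes d n :: nat and X :: "real mat" and \<sigma> :: "real \<Rightarrow> real" and l :: real
  assumes X: "X \<in> carrier_mat d n" and lip: "l-lipschitz_on UNIV \<sigma>"
begin

definition feature :: "nat \<Rightarrow> (nat \<Rightarrow> real) \<Rightarrow> real" where
  "feature i w = \<sigma> (\<Sum>j<d. X $$ (j, i) * w j)"

definition ridge :: "real vec \<Rightarrow> (nat \<Rightarrow> real) \<Rightarrow> real" where
  "ridge a w = (\<Sum>i<n. a $ i * feature i w)"

definition mean :: "real vec \<Rightarrow> real" where
  "mean a = (\<integral>w. ridge a w \<partial>gaussian_vector d)"

text \<open>The Lipschitz constant of \<open>ridge a\<close> for \<open>\<parallel>a\<parallel> \<le> 1\<close>.\<close>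

definition L :: real where
  "L = l * spectral_norm X"

lemma l_nonneg: "0 \<le> l"
  by (rule lipschitz_on_nonneg[OF lip])

lemma L_nonneg: "0 \<le> L"
  by (simp add: L_def l_nonneg spectral_norm_nonneg)

lemma feature_measurable [measurable]: "feature i \<in> borel_measurable (gaussian_vector d)"
proof -
  note [measurable] = lipschitz_borel_measurable[OF lip]
  show ?thesis unfolding feature_def by measurable
qed

lemma ridge_measurable [measurable]: "ridge a \<in> borel_measurable (gaussian_vector d)"
  unfolding ridge_def by measurable

lemma feature_exp_bound:
  obtains K where "\<And>w. \<bar>feature i w\<bar> \<le> K * exp (\<Sum>j<d. \<bar>w j\<bar>)" "0 \<le> K"
proof
  define c where "c = (\<Sum>j<d. \<bar>X $$ (j, i)\<bar>)"
  have c0: "0 \<le> c" by (simp add: c_def sum_nonneg)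
  show "0 \<le> \<bar>\<sigma> 0\<bar> + l * c" using l_nonneg c0 by simp
  fix w :: "nat \<Rightarrow> real"
  let ?S = "\<Sum>j<d. \<bar>w j\<bar>"
  have "\<bar>\<Sum>j<d. X $$ (j, i) * w j\<bar> \<le> (\<Sum>j<d. \<bar>X $$ (j, i)\<bar> * ?S)"
  proof (intro order.trans[OF sum_abs] sum_mono)
    fix j assume j: "j \<in> {..<d}"
    have "\<bar>w j\<bar> \<le> ?S" using j by (intro member_le_sum) auto
    then show "\<bar>X $$ (j, i) * w j\<bar> \<le> \<bar>X $$ (j, i)\<bar> * ?S"
      by (simp add: abs_mult mult_left_mono)
  qed
  then have u: "\<bar>\<Sum>j<d. X $$ (j, i) * w j\<bar> \<le> c * ?S"
    by (simp add: c_def sum_distrib_right)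
  have "1 + ?S \<le> exp ?S" "0 \<le> ?S"
    by (auto simp: sum_nonneg)
  then have S: "1 \<le> exp ?S" "?S \<le> exp ?S"
    by linarith+
  have "\<bar>feature i w\<bar> \<le> \<bar>\<sigma> 0\<bar> + l * \<bar>\<Sum>j<d. X $$ (j, i) * w j\<bar>"
    using lipschitz_onD[OF lip, of "\<Sum>j<d. X $$ (j, i) * w j" 0] by (simp add: feature_def dist_real_def)
  also have "\<dots> \<le> \<bar>\<sigma> 0\<bar> * exp ?S + l * (c * exp ?S)"
    using S u l_nonneg c0
    by (intro add_mono mult_left_mono order.trans[OF u]) (auto simp: mult_le_cancel_left1)
  finally show "\<bar>feature i w\<bar> \<le> (\<bar>\<sigma> 0\<bar> + l * c) * exp ?S"
    by (simp add: distrib_right mult.assoc)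
qed

lemma integrable_feature: "integrable (gaussian_vector d) (feature i)"
proof -
  obtain K where "\<And>w. \<bar>feature i w\<bar> \<le> K * exp (\<Sum>j<d. \<bar>w j\<bar>)"
    using feature_exp_bound[of i] by blast
  then show ?thesis
    by (intro integrable_gaussian_vector_exp_bound[where A = K and c = 1]) simp_all
qed

lemma integrable_feature_product: "integrable (gaussian_vector d) (\<lambda>w. feature i w * feature k w)"
proof -
  obtain K where K: "\<And>w. \<bar>feature i w\<bar> \<le> K * exp (\<Sum>j<d. \<bar>w j\<bar>)" "0 \<le> K"
    using feature_exp_bound[of i] by blast
  obtain K' where K': "\<And>w. \<bar>feature k w\<bar> \<le> K' * exp (\<Sum>j<d. \<bar>w j\<bar>)" "0 \<le> K'"
    using feature_exp_bound[of k] by blast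
  have "\<bar>feature i w * feature k w\<bar> \<le> (K * K') * exp (2 * (\<Sum>j<d. \<bar>w j\<bar>))" for w
    using mult_mono[OF K(1)[of w] K'(1)[of w]] K(2)
    by (simp add: abs_mult exp_double power2_eq_square mult_ac)
  then show ?thesis
    by (intro integrable_gaussian_vector_exp_bound[where A = "K * K'" and c = 2]) simp_all
qed

lemma integrable_ridge: "integrable (gaussian_vector d) (ridge a)"
  unfolding ridge_def by (simp add: integrable_feature)

lemma ridge_square: "(ridge a w)\<^sup>2 = (\<Sum>i<n. \<Sum>k<n. a $ i * a $ k * (feature i w * feature k w))"
  unfolding ridge_def power2_eq_square sum_product by (simp add: mult_ac)

lemma integrable_ridge_square: "integrable (gaussian_vector d) (\<lambda>w. (ridge a w)\<^sup>2)"
  unfolding ridge_square by (simp add: integrable_feature_product)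

lemma Phi_entry:
  assumes "i < n" "k < n"
  shows "Phi \<sigma> X $$ (i, k) = (\<integral>w. feature i w * feature k w \<partial>gaussian_vector d)"
proof -
  have dims: "dim_row X = d" "dim_col X = n" using X by auto
  have entry: "map_mat \<sigma> (mat_of_row (vec d w) * X) $$ (0, i) = feature i w" if "i < n" for i w
    using that X dims
    by (auto simp: feature_def scalar_prod_def mat_of_row_def atLeast0LessThan mult.commute intro!: arg_cong[where f=\<sigma>] sum.cong)
  show ?thesis
    using assms dims entry
    by (simp add: Phi_def Let_def scalar_prod_def)
qed

lemma empirical_entry:
  assumes "i < n" "r < d1"
  shows "map_mat \<sigma> (mat d1 d \<omega> * X) $$ (r, i) = feature i (\<lambda>j\<in>{..<d}. \<omega> (r, j))"
  using assms X
  by (auto simp: feature_def scalar_prod_def atLeast0LessThan mult.commute intro!: arg_cong[where f=\<sigma>] sum.cong)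

definition deviation :: "nat \<Rightarrow> (nat \<times> nat \<Rightarrow> real) \<Rightarrow> real mat" where
  "deviation d1 \<omega> = (let Y = map_mat \<sigma> (mat d1 d \<omega> * X)
    in (1 / real d1) \<cdot>\<^sub>m (transpose_mat Y * Y) - Phi \<sigma> X)"

lemma deviation_carrier: "deviation d1 \<omega> \<in> carrier_mat n n"
  using X by (auto simp: deviation_def Let_def Phi_def)

lemma deviation_entry:
  assumes "i < n" "k < n"
  shows "deviation d1 \<omega> $$ (i, k) =
    (1 / real d1) * (\<Sum>r<d1. feature i (\<lambda>j\<in>{..<d}. \<omega> (r, j)) * feature k (\<lambda>j\<in>{..<d}. \<omega> (r, j)))
      - (\<integral>w. feature i w * feature k w \<partial>gaussian_vector d)"
proof -
  define Y where "Y = map_mat \<sigma> (mat d1 d \<omega> * X)"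
  have Y: "Y \<in> carrier_mat d1 n" using X by (auto simp: Y_def)
  have "(transpose_mat Y * Y) $$ (i, k) = (\<Sum>r<d1. Y $$ (r, i) * Y $$ (r, k))"
    using Y assms by (simp add: scalar_prod_def atLeast0LessThan)
  also have "\<dots> = (\<Sum>r<d1. feature i (\<lambda>j\<in>{..<d}. \<omega> (r, j)) * feature k (\<lambda>j\<in>{..<d}. \<omega> (r, j)))"
    unfolding Y_def by (intro sum.cong refl) (simp only: empirical_entry assms lessThan_iff)
  finally have YY: "(transpose_mat Y * Y) $$ (i, k) = \<dots>" .
  have Phi: "Phi \<sigma> X \<in> carrier_mat n n" using X by (auto simp: Phi_def)
  show ?thesis
    using assms Y Phi unfolding deviation_def Let_def Y_def[symmetric]
    by (simp add: YY Phi_entry)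
qed

lemma deviation_symmetric: "transpose_mat (deviation d1 \<omega>) = deviation d1 \<omega>"
  using deviation_carrier[of d1 \<omega>] by (intro eq_matI) (auto simp: deviation_entry mult.commute)

lemma deviation_quadratic_form:
  assumes a: "a \<in> carrier_vec n"
  shows "a \<bullet> (deviation d1 \<omega> *\<^sub>v a) =
    (1 / real d1) * (\<Sum>r<d1. (ridge a (\<lambda>j\<in>{..<d}. \<omega> (r, j)))\<^sup>2) - (\<integral>w. (ridge a w)\<^sup>2 \<partial>gaussian_vector d)"
proof -
  let ?f = "\<lambda>i r. feature i (\<lambda>j\<in>{..<d}. \<omega> (r, j))"
  have "a \<bullet> (deviation d1 \<omega> *\<^sub>v a) = (\<Sum>i<n. \<Sum>k<n. a $ i * a $ k * deviation d1 \<omega> $$ (i, k))"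
    using a deviation_carrier[of d1 \<omega>]
    by (simp add: scalar_prod_def atLeast0LessThan sum_distrib_left mult_ac)
  also have "\<dots> = (\<Sum>i<n. \<Sum>k<n. a $ i * a $ k * ((1 / real d1) * (\<Sum>r<d1. ?f i r * ?f k r)))
      - (\<Sum>i<n. \<Sum>k<n. a $ i * a $ k * (\<integral>w. feature i w * feature k w \<partial>gaussian_vector d))"
    by (simp add: deviation_entry right_diff_distrib sum_subtractf)
  also have "(\<Sum>i<n. \<Sum>k<n. a $ i * a $ k * ((1 / real d1) * (\<Sum>r<d1. ?f i r * ?f k r)))
      = (1 / real d1) * (\<Sum>r<d1. (ridge a (\<lambda>j\<in>{..<d}. \<omega> (r, j)))\<^sup>2)"
  proof -
    have "(\<Sum>r<d1. (ridge a (\<lambda>j\<in>{..<d}. \<omega> (r, j)))\<^sup>2)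
        = (\<Sum>i<n. \<Sum>k<n. \<Sum>r<d1. a $ i * a $ k * (?f i r * ?f k r))"
      unfolding ridge_square by (subst sum.swap) (intro sum.cong refl sum.swap)
    then show ?thesis
      by (simp add: sum_distrib_left mult_ac)
  qed
  also have "(\<Sum>i<n. \<Sum>k<n. a $ i * a $ k * (\<integral>w. feature i w * feature k w \<partial>gaussian_vector d))
      = (\<integral>w. (ridge a w)\<^sup>2 \<partial>gaussian_vector d)"
    unfolding ridge_square by (simp add: integrable_feature_product)
  finally show ?thesis .
qed

lemma spectral_norm_deviation_measurable:
  "{\<omega> \<in> space (gaussian_matrix d1 d). spectral_norm (deviation d1 \<omega>) \<le> c} \<in> sets (gaussian_matrix d1 d)"
proof -
  obtain D where D: "countable D" "D \<subseteq> carrier_vec n"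
    "\<And>A c. dim_col A = n \<Longrightarrow> spectral_norm A \<le> c \<longleftrightarrow> (\<forall>v\<in>D. l2_norm (A *\<^sub>v v) \<le> c)"
    using countable_spectral_norm_test[of n] by metis
  have [measurable]: "(\<lambda>\<omega>. feature i (\<lambda>j\<in>{..<d}. \<omega> (r, j))) \<in> borel_measurable (gaussian_matrix d1 d)"
    if "r \<in> {..<d1}" for i r
    using measurable_compose[OF measurable_gaussian_matrix_row feature_measurable] that by simp
  have norm: "l2_norm (deviation d1 \<omega> *\<^sub>v v) = sqrt (\<Sum>i<n. (\<Sum>k<n.
      ((1 / real d1) * (\<Sum>r<d1. feature i (\<lambda>j\<in>{..<d}. \<omega> (r, j)) * feature k (\<lambda>j\<in>{..<d}. \<omega> (r, j)))
      - (\<integral>w. feature i w * feature k w \<partial>gaussian_vector d)) * v $ k)\<^sup>2)" if "v \<in> D" for v \<omega>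
  proof -
    have v: "v \<in> carrier_vec n" using D that by auto
    show ?thesis
      using v deviation_carrier[of d1 \<omega>]
      by (simp add: l2_norm_def L2_set_def scalar_prod_def atLeast0LessThan deviation_entry)
  qed
  have "{\<omega> \<in> space (gaussian_matrix d1 d). spectral_norm (deviation d1 \<omega>) \<le> c}
      = {\<omega> \<in> space (gaussian_matrix d1 d). \<forall>v\<in>D. l2_norm (deviation d1 \<omega> *\<^sub>v v) \<le> c}"
    using D(3) deviation_carrier[of d1] by auto
  also have "\<dots> \<in> sets (gaussian_matrix d1 d)"
  proof (rule sets.sets_Collect_countable_All'[OF _ D(1)])
    fix v assume "v \<in> D"
    then show "{\<omega> \<in> space (gaussian_matrix d1 d). l2_norm (deviation d1 \<omega> *\<^sub>v v) \<le> c} \<in> sets (gaussian_matrix d1 d)"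
      unfolding norm[OF \<open>v \<in> D\<close>] by measurable
  qed
  finally show ?thesis .
qed

text \<open>The gradient of \<open>ridge a\<close> is \<open>X b\<close> for a vector \<open>b\<close> with \<open>\<parallel>b\<parallel> \<le> l\<close>. The variance proxy \<open>\<pi>\<^sup>2 L\<^sup>2 / 4\<close> of the
  Maurey--Pisier inequality is rounded up to \<open>(2 L)\<^sup>2\<close>.\<close>

lemma ridge_mgf:
  assumes a: "a \<in> carrier_vec n" "l2_norm a \<le> 1"
  shows "(\<integral>\<^sup>+w. ennreal (exp (t * (ridge a w - mean a))) \<partial>gaussian_vector d) \<le> ennreal (exp (t\<^sup>2 * (2 * L)\<^sup>2 / 2))"
proof -
  interpret G: prob_space "gaussian_vector d" by (rule prob_space_gaussian_vector)
  have op: "(\<Sum>j<d. (\<Sum>i<n. X $$ (j, i) * b i)\<^sup>2) \<le> L\<^sup>2" if b: "\<And>i. i < n \<Longrightarrow> \<bar>b i\<bar> \<le> l * \<bar>a $ i\<bar>" for b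
  proof -
    have "(l2_norm (vec n b))\<^sup>2 \<le> (l * l2_norm a)\<^sup>2"
    proof -
      have "(\<Sum>i<n. (b i)\<^sup>2) \<le> (\<Sum>i<n. (l * \<bar>a $ i\<bar>)\<^sup>2)"
        using b l_nonneg by (intro sum_mono abs_le_square_iff[THEN iffD1]) simp
      then show ?thesis
        using a by (simp add: l2_norm_power2 power_mult_distrib sum_distrib_left)
    qed
    then have "l2_norm (vec n b) \<le> l * l2_norm a"
      by (rule power2_le_imp_le) (simp add: l_nonneg l2_norm_nonneg)
    also have "\<dots> \<le> l"
      by (rule mult_left_le[OF a(2) l_nonneg])
    finally have nb: "l2_norm (vec n b) \<le> l" .
    have "(\<Sum>j<d. (\<Sum>i<n. X $$ (j, i) * b i)\<^sup>2) = (l2_norm (X *\<^sub>v vec n b))\<^sup>2"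
      using X by (simp add: l2_norm_power2 scalar_prod_def atLeast0LessThan)
    also have "\<dots> \<le> (spectral_norm X * l2_norm (vec n b))\<^sup>2"
      using X by (intro power_mono l2_norm_mult_le_spectral_norm l2_norm_nonneg) auto
    also have "\<dots> \<le> (spectral_norm X * l)\<^sup>2"
      using nb by (intro power_mono mult_left_mono) (auto simp: spectral_norm_nonneg l2_norm_nonneg)
    finally show ?thesis by (simp add: L_def mult.commute)
  qed
  have "(\<integral>\<^sup>+w. ennreal (exp (t * (ridge a w - mean a))) \<partial>gaussian_vector d)
      \<le> (\<integral>\<^sup>+p. ennreal (exp (t * (ridge a (snd p) - ridge a (fst p))))
          \<partial>(gaussian_vector d \<Otimes>\<^sub>M gaussian_vector d))"
    unfolding mean_def by (rule G.nn_integral_exp_centered_le[OF integrable_ridge])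
  also have "\<dots> \<le> ennreal (exp (t\<^sup>2 * pi\<^sup>2 * L\<^sup>2 / 8))"
    unfolding ridge_def feature_def
    using ridge_sum_exp_difference[where X = "\<lambda>j i. X $$ (j, i)" and a = "\<lambda>i. a $ i"
        and n = n and d = d and L = L and t = t, OF lip] op
    by blast
  also have "\<dots> \<le> ennreal (exp (t\<^sup>2 * (2 * L)\<^sup>2 / 2))"
  proof -
    have "pi\<^sup>2 \<le> 4\<^sup>2"
      using pi_less_4 by (intro power_mono) auto
    then have "(t\<^sup>2 * L\<^sup>2) * pi\<^sup>2 \<le> (t\<^sup>2 * L\<^sup>2) * 4\<^sup>2"
      by (rule mult_left_mono) simp
    then have "t\<^sup>2 * pi\<^sup>2 * L\<^sup>2 / 8 \<le> t\<^sup>2 * (2 * L)\<^sup>2 / 2"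
      by (simp add: power_mult_distrib mult.assoc mult.commute[of "L\<^sup>2"])
    then show ?thesis
      by (intro ennreal_leI) simp
  qed
  finally show ?thesis .
qed

text \<open>The mean of \<open>\<sigma>(x\<^sub>i\<^sup>T w)\<close> depends on \<open>\<parallel>x\<^sub>i\<parallel>\<close> only and is at most \<open>l \<bar>\<parallel>x\<^sub>i\<parallel>\<^sup>2 - 1\<bar>\<close>; the Cauchy--Schwarz inequality
  sums these bounds to \<open>l B\<close>.\<close>

lemma abs_mean_le:
  assumes centered: "(\<integral>z. \<sigma> z \<partial>std_normal_distribution) = 0"
    and B: "(\<Sum>i<n. ((l2_norm (col X i))\<^sup>2 - 1)\<^sup>2) \<le> B\<^sup>2" "0 \<le> B"
    and a: "a \<in> carrier_vec n" "l2_norm a \<le> 1"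
  shows "\<bar>mean a\<bar> \<le> l * B"
proof -
  let ?r = "\<lambda>i. l2_norm (col X i)"
  have m: "\<bar>\<integral>w. feature i w \<partial>gaussian_vector d\<bar> \<le> l * \<bar>(?r i)\<^sup>2 - 1\<bar>" if "i < n" for i
  proof -
    note [measurable] = lipschitz_borel_measurable[OF lip]
    have r: "?r i = L2_set (\<lambda>j. X $$ (j, i)) {..<d}"
      using X that unfolding l2_norm_def by (intro L2_set_cong) auto
    have "(\<integral>w. feature i w \<partial>gaussian_vector d)
        = (\<integral>y. \<sigma> y \<partial>distr (gaussian_vector d) borel (\<lambda>w. \<Sum>j<d. X $$ (j, i) * w j))"
      unfolding feature_def by (subst integral_distr) simp_all
    also have "\<dots> = (\<integral>z. \<sigma> (?r i * z) \<partial>std_normal_distribution)"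
      unfolding distr_linear_gaussian_vector r by (subst integral_distr) simp_all
    finally show ?thesis
      using abs_expectation_lipschitz_scaled_le[OF lip centered l2_norm_nonneg] by simp
  qed
  have "mean a = (\<Sum>i<n. a $ i * (\<integral>w. feature i w \<partial>gaussian_vector d))"
    unfolding mean_def ridge_def by (simp add: integrable_feature)
  then have "\<bar>mean a\<bar> \<le> (\<Sum>i<n. \<bar>a $ i\<bar> * \<bar>\<integral>w. feature i w \<partial>gaussian_vector d\<bar>)"
    by (simp only: abs_mult[symmetric] sum_abs)
  also have "\<dots> \<le> (\<Sum>i<n. \<bar>a $ i\<bar> * \<bar>l * \<bar>(?r i)\<^sup>2 - 1\<bar>\<bar>)"
    using m l_nonneg by (intro sum_mono mult_left_mono) auto
  also have "\<dots> \<le> L2_set (\<lambda>i. a $ i) {..<n} * L2_set (\<lambda>i. l * \<bar>(?r i)\<^sup>2 - 1\<bar>) {..<n}"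
    by (rule L2_set_mult_ineq)
  also have "\<dots> \<le> 1 * (l * B)"
  proof (rule mult_mono)
    show "L2_set (\<lambda>i. a $ i) {..<n} \<le> 1" using a by (simp add: l2_norm_def)
    have "(\<Sum>i<n. (l * \<bar>(?r i)\<^sup>2 - 1\<bar>)\<^sup>2) \<le> (l * B)\<^sup>2"
      using B mult_left_mono[OF B(1), of "l\<^sup>2"] by (simp add: power_mult_distrib sum_distrib_left)
    then show "L2_set (\<lambda>i. l * \<bar>(?r i)\<^sup>2 - 1\<bar>) {..<n} \<le> l * B"
      unfolding L2_set_def using l_nonneg B by (intro real_le_lsqrt) (auto intro: sum_nonneg)
  qed (auto simp: L2_set_nonneg)
  finally show ?thesis by simp
qed

definition linear_sum :: "real vec \<Rightarrow> nat \<Rightarrow> (nat \<times> nat \<Rightarrow> real) \<Rightarrow> real" where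
  "linear_sum a d1 \<omega> = (\<Sum>r<d1. ridge a (\<lambda>j\<in>{..<d}. \<omega> (r, j)) - mean a)"

definition square_sum :: "real vec \<Rightarrow> nat \<Rightarrow> (nat \<times> nat \<Rightarrow> real) \<Rightarrow> real" where
  "square_sum a d1 \<omega> = (\<Sum>r<d1. (ridge a (\<lambda>j\<in>{..<d}. \<omega> (r, j)) - mean a)\<^sup>2
      - (\<integral>w. (ridge a w - mean a)\<^sup>2 \<partial>gaussian_vector d))"

lemma linear_sum_measurable [measurable]: "linear_sum a d1 \<in> borel_measurable (gaussian_matrix d1 d)"
  and square_sum_measurable [measurable]: "square_sum a d1 \<in> borel_measurable (gaussian_matrix d1 d)"
proof -
  have [measurable]: "(\<lambda>\<omega>. ridge a (\<lambda>j\<in>{..<d}. \<omega> (r, j))) \<in> borel_measurable (gaussian_matrix d1 d)"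
    if "r \<in> {..<d1}" for r
    using measurable_compose[OF measurable_gaussian_matrix_row ridge_measurable] that by simp
  show "linear_sum a d1 \<in> borel_measurable (gaussian_matrix d1 d)"
    "square_sum a d1 \<in> borel_measurable (gaussian_matrix d1 d)"
    unfolding linear_sum_def square_sum_def by measurable
qed

text \<open>With \<open>q = sqrt (n / d1)\<close>, the parameter \<open>t = 2 q / L\<close> minimizes the Chernoff exponent
  \<open>2 d1 t\<^sup>2 L\<^sup>2 - 8 d1 t L q\<close>, whose minimum is \<open>- 8 n\<close>.\<close>

lemma linear_sum_tail:
  assumes a: "a \<in> carrier_vec n" "l2_norm a \<le> 1" and L: "0 < L" and d1: "1 \<le> d1" and n: "1 \<le> n"
  shows "emeasure (gaussian_matrix d1 d)
      {\<omega> \<in> space (gaussian_matrix d1 d). real d1 * (8 * L * sqrt (real n / real d1)) \<le> \<bar>linear_sum a d1 \<omega>\<bar>}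
    \<le> ennreal (2 * exp (- 8 * real n))"
proof -
  define q where "q = sqrt (real n / real d1)"
  have q: "q > 0" "real d1 * q\<^sup>2 = real n"
    using d1 n by (auto simp: q_def)
  define t where "t = 2 * q / L"
  have "emeasure (gaussian_matrix d1 d)
      {\<omega> \<in> space (gaussian_matrix d1 d). real d1 * (8 * L * q) \<le> \<bar>\<Sum>r<d1. ridge a (\<lambda>j\<in>{..<d}. \<omega> (r, j)) - mean a\<bar>}
    \<le> ennreal (2 * exp (real d1 * (t\<^sup>2 * (2 * L)\<^sup>2 / 2) - t * (real d1 * (8 * L * q))))"
  proof (rule gaussian_matrix_row_sum_two_sided[where h = "\<lambda>w. ridge a w - mean a"])
    show "0 < t" using q L by (simp add: t_def)
    fix t' :: real assume "\<bar>t'\<bar> = t"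
    then have "t'\<^sup>2 = t\<^sup>2" by (metis power2_abs)
    then show "(\<integral>\<^sup>+w. ennreal (exp (t' * (ridge a w - mean a))) \<partial>gaussian_vector d) \<le> ennreal (exp (t\<^sup>2 * (2 * L)\<^sup>2 / 2))"
      using ridge_mgf[OF a, of t'] by simp
  qed measurable
  also have "real d1 * (t\<^sup>2 * (2 * L)\<^sup>2 / 2) - t * (real d1 * (8 * L * q)) = - 8 * (real d1 * q\<^sup>2)"
  proof -
    have Lt: "L * t = 2 * q" using L by (simp add: t_def)
    have sq: "t\<^sup>2 * (2 * L)\<^sup>2 / 2 = 2 * (L * t)\<^sup>2"
      by (simp add: power_mult_distrib)
    have lin: "t * (real d1 * (8 * L * q)) = 8 * q * real d1 * (L * t)"
      by (simp only: mult_ac)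
    show ?thesis
      unfolding sq lin Lt by (simp add: power2_eq_square)
  qed
  finally show ?thesis
    unfolding linear_sum_def q_def[symmetric] q(2) .
qed

text \<open>With \<open>q = sqrt (n / d1)\<close>, the parameter is \<open>t = min 1 q / (16 L\<^sup>2)\<close>: the sub-exponential bound is available up to
  \<open>1 / (16 L\<^sup>2)\<close> only, and the truncation produces the term \<open>n / d1\<close> in the regime \<open>n > d1\<close>.\<close>

lemma square_sum_tail:
  assumes a: "a \<in> carrier_vec n" "l2_norm a \<le> 1" and L: "0 < L" and d1: "1 \<le> d1" and n: "1 \<le> n"
  shows "emeasure (gaussian_matrix d1 d)
      {\<omega> \<in> space (gaussian_matrix d1 d).
        real d1 * (144 * L\<^sup>2 * (sqrt (real n / real d1) + real n / real d1)) \<le> \<bar>square_sum a d1 \<omega>\<bar>}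
    \<le> ennreal (2 * exp (- 6 * real n))"
proof -
  interpret G: prob_space "gaussian_vector d" by (rule prob_space_gaussian_vector)
  define q where "q = sqrt (real n / real d1)"
  have q: "q > 0" "real d1 * q\<^sup>2 = real n" "real n / real d1 = q\<^sup>2"
    using d1 n by (auto simp: q_def)
  define p where "p = min 1 q"
  have p: "0 < p" "p \<le> 1" using q by (auto simp: p_def)
  define t where "t = p / (16 * L\<^sup>2)"
  have tL: "16 * L\<^sup>2 * t = p"
    using L by (simp add: t_def)
  have cL: "4 * (2 * L)\<^sup>2 = 16 * L\<^sup>2"
    by (simp add: power_mult_distrib)
  define v where "v = (\<integral>w. (ridge a w - mean a)\<^sup>2 \<partial>gaussian_vector d)"
  have "emeasure (gaussian_matrix d1 d)
      {\<omega> \<in> space (gaussian_matrix d1 d). real d1 * (144 * L\<^sup>2 * (q + q\<^sup>2))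
        \<le> \<bar>\<Sum>r<d1. (ridge a (\<lambda>j\<in>{..<d}. \<omega> (r, j)) - mean a)\<^sup>2 - v\<bar>}
    \<le> ennreal (2 * exp (real d1 * (3 * p\<^sup>2) - t * (real d1 * (144 * L\<^sup>2 * (q + q\<^sup>2)))))"
  proof (rule gaussian_matrix_row_sum_two_sided[where h = "\<lambda>w. (ridge a w - mean a)\<^sup>2 - v"])
    show "0 < t" using p L by (simp add: t_def)
    fix t' :: real assume t': "\<bar>t'\<bar> = t"
    then have "t'\<^sup>2 = t\<^sup>2" by (metis power2_abs)
    then have sq: "(4 * (2 * L)\<^sup>2 * t')\<^sup>2 = p\<^sup>2"
      unfolding cL tL[symmetric] by (simp only: power_mult_distrib[of "16 * L\<^sup>2"])
    have "\<bar>t'\<bar> \<le> 1 / (4 * (2 * L)\<^sup>2)"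
      unfolding t' t_def cL by (rule divide_right_mono[OF p(2)]) simp
    then show "(\<integral>\<^sup>+w. ennreal (exp (t' * ((ridge a w - mean a)\<^sup>2 - v))) \<partial>gaussian_vector d) \<le> ennreal (exp (3 * p\<^sup>2))"
      using G.subgaussian_centered_square_mgf[of "\<lambda>w. ridge a w - mean a" "2 * L" t'] L ridge_mgf[OF a]
      unfolding sq v_def by simp
  qed measurable
  also have "\<dots> \<le> ennreal (2 * exp (- 6 * real n))"
  proof -
    have "t * (real d1 * (144 * L\<^sup>2 * (q + q\<^sup>2))) = 9 * p * (real d1 * (q + q\<^sup>2))"
      unfolding tL[symmetric] by simp
    moreover have "real d1 * (3 * p\<^sup>2) - 9 * p * (real d1 * (q + q\<^sup>2)) \<le> - 6 * (real d1 * q\<^sup>2)"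
    proof -
      have "3 * p\<^sup>2 - 9 * p * (q + q\<^sup>2) \<le> - 6 * q\<^sup>2"
      proof (cases "q \<le> 1")
        case True
        then have "p = q" by (simp add: p_def)
        then have "3 * p\<^sup>2 - 9 * p * (q + q\<^sup>2) = - 6 * q\<^sup>2 - 9 * (q * q\<^sup>2)"
          by (simp add: power2_eq_square distrib_left)
        then show ?thesis using q(1) by simp
      next
        case False
        then have "p = 1" "1 \<le> q" by (auto simp: p_def)
        then have "1 \<le> q\<^sup>2" by (simp add: one_le_power)
        moreover have "3 * p\<^sup>2 - 9 * p * (q + q\<^sup>2) = 3 - 9 * q - 9 * q\<^sup>2"
          using \<open>p = 1\<close> by simp
        ultimately show ?thesis using \<open>1 \<le> q\<close> by linarith
      qed
      then have "real d1 * (3 * p\<^sup>2 - 9 * p * (q + q\<^sup>2)) \<le> real d1 * (- 6 * q\<^sup>2)"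
        by (rule mult_left_mono) simp
      then show ?thesis by (simp only: right_diff_distrib mult_ac)
    qed
    ultimately have "real d1 * (3 * p\<^sup>2) - t * (real d1 * (144 * L\<^sup>2 * (q + q\<^sup>2))) \<le> - 6 * real n"
      by (simp only: q(2))
    then show ?thesis
      by (intro ennreal_leI) simp
  qed
  finally show ?thesis
    unfolding square_sum_def v_def[symmetric] q_def[symmetric] unfolding q(3) .
qed

lemma quadratic_form_eq_sums:
  assumes a: "a \<in> carrier_vec n" and d1: "1 \<le> d1"
  shows "a \<bullet> (deviation d1 \<omega> *\<^sub>v a)
    = (1 / real d1) * square_sum a d1 \<omega> + 2 * mean a * ((1 / real d1) * linear_sum a d1 \<omega>)"
proof -
  interpret G: prob_space "gaussian_vector d" by (rule prob_space_gaussian_vector)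
  let ?f = "\<lambda>r. ridge a (\<lambda>j\<in>{..<d}. \<omega> (r, j))"
  have Ev: "(\<integral>w. (ridge a w - mean a)\<^sup>2 \<partial>gaussian_vector d) = (\<integral>w. (ridge a w)\<^sup>2 \<partial>gaussian_vector d) - (mean a)\<^sup>2"
    using G.variance_eq[OF integrable_ridge integrable_ridge_square, of a] by (simp add: mean_def)
  have "(\<Sum>r<d1. (?f r)\<^sup>2) = (\<Sum>r<d1. ((?f r - mean a)\<^sup>2 - (\<integral>w. (ridge a w - mean a)\<^sup>2 \<partial>gaussian_vector d))
      + 2 * mean a * (?f r - mean a) + (\<integral>w. (ridge a w)\<^sup>2 \<partial>gaussian_vector d))"
    unfolding Ev by (intro sum.cong refl) (simp add: power2_eq_square algebra_simps)
  also have "\<dots> = square_sum a d1 \<omega> + 2 * mean a * linear_sum a d1 \<omega>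
      + real d1 * (\<integral>w. (ridge a w)\<^sup>2 \<partial>gaussian_vector d)"
    unfolding square_sum_def linear_sum_def sum.distrib sum_distrib_left[symmetric] by simp
  finally show ?thesis
    unfolding deviation_quadratic_form[OF a] using d1 by (simp add: field_simps)
qed

text \<open>The tail bounds divide by \<open>L\<close>. If \<open>L = 0\<close>, either \<open>\<sigma>\<close> is constant or \<open>X\<close> vanishes, and the features are not random.\<close>

lemma ridge_constant:
  assumes "L = 0"
  shows "ridge a w = ridge a w'"
proof -
  have "feature i w = feature i w'" if i: "i < n" for i
  proof (cases "l = 0")
    case True
    then show ?thesis
      using lipschitz_onD[OF lip, of "\<Sum>j<d. X $$ (j, i) * w j" "\<Sum>j<d. X $$ (j, i) * w' j"]
      by (simp add: feature_def)
  next
    case False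
    then have "spectral_norm X = 0" using assms by (simp add: L_def)
    moreover have Xi: "X *\<^sub>v unit_vec n i = col X i"
      using X i by (intro eq_vecI) auto
    ultimately have "l2_norm (X *\<^sub>v unit_vec n i) \<le> 0"
      using l2_norm_mult_le_spectral_norm[of "unit_vec n i" X] X by simp
    then have "(l2_norm (col X i))\<^sup>2 = 0"
      using X i l2_norm_nonneg[of "col X i"] Xi by simp
    then have "(\<Sum>j<d. (X $$ (j, i))\<^sup>2) = 0"
      using X i by (simp add: l2_norm_power2)
    then have "X $$ (j, i) = 0" if "j < d" for j
      using that by (subst (asm) sum_nonneg_eq_0_iff) auto
    then show ?thesis by (simp add: feature_def)
  qed
  then show ?thesis by (simp add: ridge_def)
qed

lemma sums_eq_zero_if_L_zero:
  assumes "L = 0"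
  shows "linear_sum a d1 \<omega> = 0" "square_sum a d1 \<omega> = 0"
proof -
  interpret G: prob_space "gaussian_vector d" by (rule prob_space_gaussian_vector)
  have "mean a = (\<integral>w. ridge a (\<lambda>_. 0) \<partial>gaussian_vector d)"
    unfolding mean_def by (intro Bochner_Integration.integral_cong refl ridge_constant[OF assms])
  then have "mean a = ridge a (\<lambda>_. 0)"
    by (simp add: G.prob_space)
  then have "ridge a w - mean a = 0" for w
    using ridge_constant[OF assms, of a w "\<lambda>_. 0"] by simp
  then show "linear_sum a d1 \<omega> = 0" "square_sum a d1 \<omega> = 0"
    by (simp_all add: linear_sum_def square_sum_def)
qed

lemma abs_sums_le_imp_spectral_norm_le:
  assumes centered: "(\<integral>z. \<sigma> z \<partial>std_normal_distribution) = 0"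
    and B: "(\<Sum>i<n. ((l2_norm (col X i))\<^sup>2 - 1)\<^sup>2) \<le> B\<^sup>2" "0 \<le> B"
    and d1: "1 \<le> d1"
    and N: "N \<subseteq> {a \<in> carrier_vec n. l2_norm a \<le> 1}"
    and net: "\<And>v. v \<in> carrier_vec n \<Longrightarrow> l2_norm v \<le> 1 \<Longrightarrow> \<exists>a\<in>N. l2_norm (v - a) \<le> 1 / 4"
    and lin: "\<And>a. a \<in> N \<Longrightarrow> \<bar>linear_sum a d1 \<omega>\<bar> \<le> real d1 * (8 * L * q)"
    and sq: "\<And>a. a \<in> N \<Longrightarrow> \<bar>square_sum a d1 \<omega>\<bar> \<le> real d1 * (144 * L\<^sup>2 * p)"
  shows "spectral_norm (deviation d1 \<omega>) \<le> 288 * p * L\<^sup>2 + 32 * B * l * L * q"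
proof -
  have "spectral_norm (deviation d1 \<omega>) \<le> 2 * (144 * L\<^sup>2 * p + 2 * (l * B) * (8 * L * q))"
  proof (rule spectral_norm_le_net[OF deviation_carrier deviation_symmetric N net])
    fix a assume aN: "a \<in> N"
    then have a: "a \<in> carrier_vec n" "l2_norm a \<le> 1" using N by auto
    have "\<bar>(1 / real d1) * square_sum a d1 \<omega>\<bar> \<le> 144 * L\<^sup>2 * p"
      using sq[OF aN] d1 by (simp add: abs_mult field_simps)
    moreover have lin': "\<bar>(1 / real d1) * linear_sum a d1 \<omega>\<bar> \<le> 8 * L * q"
      using lin[OF aN] d1 by (simp add: abs_mult field_simps)
    moreover have "\<bar>2 * mean a * ((1 / real d1) * linear_sum a d1 \<omega>)\<bar> \<le> 2 * (l * B) * (8 * L * q)"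
    proof -
      have "\<bar>2 * mean a\<bar> \<le> 2 * (l * B)"
        using abs_mean_le[OF centered B a] by simp
      then have "\<bar>2 * mean a\<bar> * \<bar>(1 / real d1) * linear_sum a d1 \<omega>\<bar> \<le> 2 * (l * B) * (8 * L * q)"
        using lin' l_nonneg B(2) by (intro mult_mono) auto
      then show ?thesis by (simp only: abs_mult)
    qed
    ultimately show "\<bar>a \<bullet> (deviation d1 \<omega> *\<^sub>v a)\<bar> \<le> 144 * L\<^sup>2 * p + 2 * (l * B) * (8 * L * q)"
      unfolding quadratic_form_eq_sums[OF a(1) d1] by linarith
  qed
  also have "\<dots> = 288 * p * L\<^sup>2 + 32 * B * l * L * q"
    by simp
  finally show ?thesis .
qed

text \<open>Union bound over the net: \<open>48\<^sup>n \<le> e\<^bsup>4n\<^esup>\<close> net points, each failing with probability at most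
  \<open>2 e\<^bsup>-8n\<^esup> + 2 e\<^bsup>-6n\<^esup> \<le> 4 e\<^bsup>-6n\<^esup>\<close>.\<close>

lemma measure_deviation_ge:
  assumes centered: "(\<integral>z. \<sigma> z \<partial>std_normal_distribution) = 0"
    and B: "(\<Sum>i<n. ((l2_norm (col X i))\<^sup>2 - 1)\<^sup>2) \<le> B\<^sup>2" "0 \<le> B"
    and d1: "1 \<le> d1" and n: "1 \<le> n"
  defines "q \<equiv> sqrt (real n / real d1)" and "p \<equiv> sqrt (real n / real d1) + real n / real d1"
  shows "measure (gaussian_matrix d1 d)
      {\<omega> \<in> space (gaussian_matrix d1 d). spectral_norm (deviation d1 \<omega>) \<le> 288 * p * L\<^sup>2 + 32 * B * l * L * q}
    \<ge> 1 - 4 * exp (- 2 * real n)"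
proof -
  let ?M = "gaussian_matrix d1 d"
  interpret M: prob_space ?M
    unfolding gaussian_matrix_def by (intro prob_space_PiM std_normal.prob_space_axioms)
  obtain N where N: "finite N" "card N \<le> 48 ^ n" "N \<subseteq> {a \<in> carrier_vec n. l2_norm a \<le> 1}"
    "\<And>v. v \<in> carrier_vec n \<Longrightarrow> l2_norm v \<le> 1 \<Longrightarrow> \<exists>a\<in>N. l2_norm (v - a) \<le> 1 / 4"
    using exists_quarter_net[OF n] by blast
  define bad where "bad a = (if L = 0 then {} else
      {\<omega> \<in> space ?M. real d1 * (8 * L * q) \<le> \<bar>linear_sum a d1 \<omega>\<bar>}
      \<union> {\<omega> \<in> space ?M. real d1 * (144 * L\<^sup>2 * p) \<le> \<bar>square_sum a d1 \<omega>\<bar>})" for a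
  have bad_sets: "bad a \<in> sets ?M" for a
  proof (cases "L = 0")
    case False
    show ?thesis unfolding bad_def if_not_P[OF False] by measurable
  qed (simp add: bad_def)
  have bad_le: "emeasure ?M (bad a) \<le> ennreal (4 * exp (- 6 * real n))" if "a \<in> N" for a
  proof (cases "L = 0")
    case False
    then have L: "0 < L" using L_nonneg by simp
    have a: "a \<in> carrier_vec n" "l2_norm a \<le> 1" using N(3) that by auto
    have "emeasure ?M (bad a) \<le> ennreal (2 * exp (- 8 * real n)) + ennreal (2 * exp (- 6 * real n))"
      unfolding bad_def if_not_P[OF False] p_def q_def
      by (intro order.trans[OF emeasure_subadditive] add_mono linear_sum_tail square_sum_tail a L d1 n) measurable
    also have "\<dots> \<le> ennreal (4 * exp (- 6 * real n))"
      by (simp flip: ennreal_plus)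
    finally show ?thesis .
  qed (simp add: bad_def)
  have "emeasure ?M (\<Union>a\<in>N. bad a) \<le> (\<Sum>a\<in>N. emeasure ?M (bad a))"
    using N(1) bad_sets by (intro emeasure_subadditive_finite) auto
  also have "\<dots> \<le> (\<Sum>a\<in>N. ennreal (4 * exp (- 6 * real n)))"
    by (intro sum_mono bad_le)
  also have "\<dots> = ennreal (real (card N) * (4 * exp (- 6 * real n)))"
    by (simp add: ennreal_of_nat_eq_real_of_nat ennreal_mult)
  also have "\<dots> \<le> ennreal (4 * exp (- 2 * real n))"
  proof (rule ennreal_leI)
    \<comment> \<open>\<open>exp 4 = (exp (1/4))\<^bsup>16\<^esup>\<close> and the quadratic Taylor polynomial of \<open>exp\<close> is accurate enough at \<open>1/4\<close>\<close>
    have "48 \<le> (1 + 1/4 + (1/4)\<^sup>2 / 2 :: real) ^ 16"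
      by (simp add: power2_eq_square power_numeral_reduce)
    also have "\<dots> \<le> exp (1/4) ^ 16"
      using exp_lower_Taylor_quadratic[of "1/4"] by (intro power_mono) auto
    also have "\<dots> = exp 4"
      by (simp flip: exp_of_nat_mult)
    finally have e4: "(48 :: real) \<le> exp 4" .
    have "real (card N) \<le> real (48 ^ n)"
      using N(2) by (simp only: of_nat_le_iff)
    also have "\<dots> \<le> exp 4 ^ n"
      using power_mono[OF e4] by simp
    also have "\<dots> = exp (4 * real n)"
      by (simp flip: exp_of_nat_mult add: mult.commute)
    finally have "real (card N) * (4 * exp (- 6 * real n)) \<le> exp (4 * real n) * (4 * exp (- 6 * real n))"
      by (rule mult_right_mono) simp
    also have "\<dots> = 4 * exp (- 2 * real n)"
      by (simp add: exp_add[symmetric] mult.left_commute)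
    finally show "real (card N) * (4 * exp (- 6 * real n)) \<le> 4 * exp (- 2 * real n)" .
  qed
  finally have bad_total: "measure ?M (\<Union>a\<in>N. bad a) \<le> 4 * exp (- 2 * real n)"
    by (simp add: M.emeasure_eq_measure)
  let ?E = "{\<omega> \<in> space ?M. spectral_norm (deviation d1 \<omega>) \<le> 288 * p * L\<^sup>2 + 32 * B * l * L * q}"
  have union_sets: "(\<Union>a\<in>N. bad a) \<in> sets ?M"
    using N(1) bad_sets by (intro sets.finite_UN) auto
  have "space ?M - (\<Union>a\<in>N. bad a) \<subseteq> ?E"
  proof (intro subsetI CollectI conjI)
    fix \<omega> assume \<omega>: "\<omega> \<in> space ?M - (\<Union>a\<in>N. bad a)"
    then show "\<omega> \<in> space ?M" by blast
    have good: "\<bar>linear_sum a d1 \<omega>\<bar> \<le> real d1 * (8 * L * q) \<and> \<bar>square_sum a d1 \<omega>\<bar> \<le> real d1 * (144 * L\<^sup>2 * p)"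
      if "a \<in> N" for a
    proof (cases "L = 0")
      case True
      then show ?thesis by (simp add: sums_eq_zero_if_L_zero)
    next
      case False
      then have "\<omega> \<notin> {\<omega> \<in> space ?M. real d1 * (8 * L * q) \<le> \<bar>linear_sum a d1 \<omega>\<bar>}"
        "\<omega> \<notin> {\<omega> \<in> space ?M. real d1 * (144 * L\<^sup>2 * p) \<le> \<bar>square_sum a d1 \<omega>\<bar>}"
        using \<omega> that by (auto simp: bad_def)
      then show ?thesis using \<omega> by (auto simp: not_le intro: less_imp_le)
    qed
    show "spectral_norm (deviation d1 \<omega>) \<le> 288 * p * L\<^sup>2 + 32 * B * l * L * q"
      using good by (intro abs_sums_le_imp_spectral_norm_le[OF centered B d1 N(3,4)]) auto
  qed
  then have "measure ?M (space ?M - (\<Union>a\<in>N. bad a)) \<le> measure ?M ?E"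
    using spectral_norm_deviation_measurable by (rule M.finite_measure_mono)
  then show ?thesis
    using bad_total M.prob_compl[OF union_sets] by simp
qed

end

theorem theorem2p3:
  "\<exists>C::real. C > 0 \<and>
    (\<forall>(d0::nat) (d1::nat) (n::nat) (X::real mat) (B::real) (l::real) (\<sigma>::real \<Rightarrow> real).
      d0 \<ge> 1 \<longrightarrow> d1 \<ge> 1 \<longrightarrow> n \<ge> 1 \<longrightarrow>
      X \<in> carrier_mat d0 n \<longrightarrow>
      B \<ge> 0 \<longrightarrow>
      (\<Sum>i<n. ((l2_norm (col X i))\<^sup>2 - 1)\<^sup>2) \<le> B\<^sup>2 \<longrightarrow>
      l-lipschitz_on UNIV \<sigma> \<longrightarrow>
      (\<integral>x. \<sigma> x \<partial>std_normal_distribution) = 0 \<longrightarrow>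
      measure (gaussian_matrix d1 d0)
        {\<omega> \<in> space (gaussian_matrix d1 d0).
          let W = mat d1 d0 \<omega>; Y = map_mat \<sigma> (W * X) in
          spectral_norm ((1 / real d1) \<cdot>\<^sub>m (transpose_mat Y * Y) - Phi \<sigma> X)
            \<le> C * (sqrt (real n / real d1) + real n / real d1) * l\<^sup>2 * (spectral_norm X)\<^sup>2
              + 32 * B * l\<^sup>2 * spectral_norm X * sqrt (real n / real d1)}
      \<ge> 1 - 4 * exp (- 2 * real n))"
proof (intro exI[of _ 288] conjI allI impI)
  fix d0 d1 n :: nat and X :: "real mat" and B l :: real and \<sigma> :: "real \<Rightarrow> real"
  assume d1: "d1 \<ge> 1" and n: "n \<ge> 1" and X: "X \<in> carrier_mat d0 n" and B: "B \<ge> 0"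
    and cols: "(\<Sum>i<n. ((l2_norm (col X i))\<^sup>2 - 1)\<^sup>2) \<le> B\<^sup>2"
    and lip: "l-lipschitz_on UNIV \<sigma>" and centered: "(\<integral>x. \<sigma> x \<partial>std_normal_distribution) = 0"
  interpret random_features d0 n X \<sigma> l
    by unfold_locales (fact X, fact lip)
  let ?q = "sqrt (real n / real d1)" and ?p = "sqrt (real n / real d1) + real n / real d1"
  have bound: "288 * ?p * L\<^sup>2 + 32 * B * l * L * ?q
      = 288 * ?p * l\<^sup>2 * (spectral_norm X)\<^sup>2 + 32 * B * l\<^sup>2 * spectral_norm X * ?q"
    by (simp add: L_def power_mult_distrib power2_eq_square)
  show "measure (gaussian_matrix d1 d0)
        {\<omega> \<in> space (gaussian_matrix d1 d0).
          let W = mat d1 d0 \<omega>; Y = map_mat \<sigma> (W * X) in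
          spectral_norm ((1 / real d1) \<cdot>\<^sub>m (transpose_mat Y * Y) - Phi \<sigma> X)
            \<le> 288 * ?p * l\<^sup>2 * (spectral_norm X)\<^sup>2 + 32 * B * l\<^sup>2 * spectral_norm X * ?q}
      \<ge> 1 - 4 * exp (- 2 * real n)"
    using measure_deviation_ge[OF centered cols B d1 n]
    unfolding bound deviation_def Let_def .
qed simp

end
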